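(* Fix an integer $\ell\ge 1$, let $\varphi(\xi)=1-\cos(2\pi\xi)=2\sin^2(\pi\xi)$, and let $\omega=\varphi\bigl(\tfrac{1}{2\ell}\bigr)$. Then for every $f\in GPW_\omega(\mathbb{Z})$, $$f(m)=\sum_{j\in\mathbb{Z}}f(\ell j)\,\operatorname{sinc}\Bigl(\frac{m}{\ell}-j\Bigr),\qquad m\in\mathbb{Z},$$ where the series converges in $\ell^2(\mathbb{Z})$.
   Context: $\operatorname{sinc}(x)=\frac{\sin(\pi x)}{\pi x}$ for $x\neq0$ and $\operatorname{sinc}(0)=1$. $\mathbb{T}$ is identified with $[-1/2,1/2)$ with addition modulo $1$ and Lebesgue measure; the Fourier transform is the unitary operator $\mathcal{F}:\ell^2(\mathbb{Z})\to L^2(\mathbb{T})$, $\mathcal{F}f(\xi)=\sum_{k\in\mathbb{Z}}f(k)e^{2\pi ik\xi}$. For $\omega\in[0,2]$ the Graph Paley--Wiener space $GPW_\omega(\mathbb{Z})$ is the spectral subspace of the normalized Laplacian $\mathcal{L}f(n)=\frac12(2f(n)-f(n+1)-f(n-1))$ on $\ell^2(\mathbb{Z})$ corresponding to $[0,\omega]$; equivalently, $GPW_\omega(\mathbb{Z})=\{f\in\ell^2(\mathbb{Z}):\mathcal{F}f(\xi)=0 \text{ for a.e. }\xi\in\mathbb{T}\setminus\Omega\}$ with $\Omega=\varphi^{-1}([0,\omega])$. For $\omega=\varphi(1/(2\ell))$ one has $\Omega=[-\frac{1}{2\ell},\frac{1}{2\ell}]$ (as a subset of $\mathbb{T}$).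 *)

theory Defs
  imports "HOL-Analysis.Analysis"
begin

definition phi :: "real \<Rightarrow> real" where
  "phi \<xi> = 1 - cos (2 * pi * \<xi>)"

lemma phi_eq_sin: "phi \<xi> = 2 * (sin (pi * \<xi>))\<^sup>2"
  using cos_double_sin[of "pi * \<xi>"] by (simp add: phi_def mult.assoc)

(* The normalised cardinal sine; Sinc_Integral in HOL-Probability uses sin x / x. *)
definition nsinc :: "real \<Rightarrow> real" where
  "nsinc x = (if x = 0 then 1 else sin (pi * x) / (pi * x))"


definition ell2 :: "(int \<Rightarrow> complex) set" where
  "ell2 = {f. (\<lambda>n. (cmod (f n))\<^sup>2) summable_on UNIV}"

definition ell2_inner :: "(int \<Rightarrow> complex) \<Rightarrow> (int \<Rightarrow> complex) \<Rightarrow> complex" where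
  "ell2_inner f g = (\<Sum>\<^sub>\<infinity>n. f n * cnj (g n))"

definition ell2_norm :: "(int \<Rightarrow> complex) \<Rightarrow> real" where
  "ell2_norm f = sqrt (\<Sum>\<^sub>\<infinity>n. (cmod (f n))\<^sup>2)"

(* The series of the g j over J converges (unconditionally) to f in the norm of ell2.
   Membership is required explicitly because infsum, and hence ell2_norm, is 0 on
   non-summable families. *)
definition ell2_has_sum ::
    "('j \<Rightarrow> int \<Rightarrow> complex) \<Rightarrow> 'j set \<Rightarrow> (int \<Rightarrow> complex) \<Rightarrow> bool" where
  "ell2_has_sum g J f \<longleftrightarrow>
     (\<forall>j\<in>J. g j \<in> ell2) \<and> f \<in> ell2 \<and>
     ((\<lambda>F. ell2_norm (\<lambda>n. f n - (\<Sum>j\<in>F. g j n))) \<longlongrightarrow> 0) (finite_subsets_at_top J)"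

definition ell2_projection :: "((int \<Rightarrow> complex) \<Rightarrow> (int \<Rightarrow> complex)) \<Rightarrow> bool" where
  "ell2_projection P \<longleftrightarrow>
     (\<forall>f\<in>ell2. P f \<in> ell2) \<and>
     (\<forall>f\<in>ell2. \<forall>g\<in>ell2. \<forall>a b. P (\<lambda>n. a * f n + b * g n) = (\<lambda>n. a * P f n + b * P g n)) \<and>
     (\<forall>f\<in>ell2. P (P f) = P f) \<and>
     (\<forall>f\<in>ell2. \<forall>g\<in>ell2. ell2_inner (P f) g = ell2_inner f (P g))"

(* Only the values on Borel sets and on elements of ell2 are constrained. *)
definition projection_valued_measure ::
    "(real set \<Rightarrow> (int \<Rightarrow> complex) \<Rightarrow> (int \<Rightarrow> complex)) \<Rightarrow> bool" where
  "projection_valued_measure E \<longleftrightarrow>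
     (\<forall>A\<in>sets borel. ell2_projection (E A)) \<and>
     (\<forall>f\<in>ell2. E UNIV f = f) \<and>
     (\<forall>A\<in>sets borel. \<forall>B\<in>sets borel. \<forall>f\<in>ell2. E (A \<inter> B) f = E A (E B f)) \<and>
     (\<forall>A :: nat \<Rightarrow> real set. range A \<subseteq> sets borel \<longrightarrow> disjoint_family A \<longrightarrow>
        (\<forall>f\<in>ell2. ell2_has_sum (\<lambda>i. E (A i) f) UNIV (E (\<Union>i. A i) f)))"

definition scalar_spectral_measure ::
    "(real set \<Rightarrow> (int \<Rightarrow> complex) \<Rightarrow> (int \<Rightarrow> complex)) \<Rightarrow> (int \<Rightarrow> complex) \<Rightarrow> real measure" where
  "scalar_spectral_measure E f =
     measure_of UNIV (sets borel) (\<lambda>A. ennreal (Re (ell2_inner (E A f) f)))"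

(* E is the spectral measure of T, i.e. T is the integral of x with respect to E in the
   weak sense.  The sesquilinear form of T is determined by its diagonal (polarisation), so
   complex measures are not needed.  The integral condition is imposed on all of ell2,
   which is appropriate for bounded self-adjoint T. *)
definition is_spectral_measure ::
    "((int \<Rightarrow> complex) \<Rightarrow> (int \<Rightarrow> complex)) \<Rightarrow>
     (real set \<Rightarrow> (int \<Rightarrow> complex) \<Rightarrow> (int \<Rightarrow> complex)) \<Rightarrow> bool" where
  "is_spectral_measure T E \<longleftrightarrow>
     projection_valued_measure E \<and>
     (\<forall>f\<in>ell2. integrable (scalar_spectral_measure E f) (\<lambda>x. x) \<and>
        ell2_inner (T f) f = complex_of_real (\<integral>x. x \<partial>scalar_spectral_measure E f))"

(* The range of the spectral projection E A.  By the spectral theorem a bounded self-adjoint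
   T has a spectral measure E, unique on Borel sets and ell2, so the existential
   quantifier over E amounts to a definite description. *)
definition spectral_subspace ::
    "((int \<Rightarrow> complex) \<Rightarrow> (int \<Rightarrow> complex)) \<Rightarrow> real set \<Rightarrow> (int \<Rightarrow> complex) set" where
  "spectral_subspace T A = {f \<in> ell2. \<exists>E. is_spectral_measure T E \<and> E A f = f}"


definition laplacian :: "(int \<Rightarrow> complex) \<Rightarrow> (int \<Rightarrow> complex)" where
  "laplacian f = (\<lambda>n. (1 / 2) * (2 * f n - f (n + 1) - f (n - 1)))"

(* The Fourier transform turns laplacian into multiplication by phi, so its spectral measure
   is E A f = F^{-1} (indicator (phi -` A) * F f), and GPW \<omega> consists of the f in ell2 whose
   Fourier transform vanishes a.e. outside phi -` {0..\<omega>}. *)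
definition GPW :: "real \<Rightarrow> (int \<Rightarrow> complex) set" where
  "GPW \<omega> = spectral_subspace laplacian {0..\<omega>}"

end

theory Submission
  imports Defs
begin

text \<open>
  Write \<open>N\<close> for the sampling step and \<open>s m = nsinc (m / N)\<close>. The theorem is Shannon's sampling
  formula: \<open>f\<close> has no spectrum off the band \<open>[- 1/(2 N), 1/(2 N)]\<close>. Sampling at the multiples of \<open>N\<close>
  superposes the translates of the spectrum by \<open>q / N\<close>; these overlap at most in endpoints, so
  cutting back to the band recovers \<open>f\<close>. Only the Fourier transform of explicit test sequences is taken below; that of
  \<open>f\<close> is replaced by a duality argument, which keeps the \<open>L\<^sup>2\<close> theory of Fourier series down to
  Bessel's inequality.

  \<^bold>\<open>From the spectral measure to an inequality.\<close> Put \<open>\<omega> = 2 r\<close>. The range \<open>V\<close> of the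
  spectral projection of \<open>[0, 2 r]\<close> is invariant under the Laplacian, since the
  quadratic form of the Laplacian splits along \<open>V\<close> and its complement and can be polarised
  (\<open>T_orthogonal\<close>, \<open>T_invariant\<close>). On \<open>V\<close> the form lies between \<open>0\<close> and \<open>2 r\<close>, so
  \<open>S = laplacian - r\<close> satisfies \<open>ell2_norm (S u) \<le> r * ell2_norm u\<close> there
  (\<open>centred_contraction\<close>).

  \<^bold>\<open>Orthogonality to the complementary band.\<close> Let \<open>g\<close> be the sequence of Fourier coefficients of
  \<open>G\<close> over an arc on which \<open>phi \<ge> 2 r\<close>, strictly in the interior. The Laplacian acts on such sequences by multiplying
  \<open>G\<close> by \<open>phi\<close>, so \<open>g\<close> is \<open>S ^ k\<close> applied to the coefficients of \<open>G / (phi - r) ^ k\<close>. Moving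
  \<open>S ^ k\<close> onto \<open>f \<in> V\<close> and using Bessel's inequality bounds \<open>\<bar>\<langle>f, g\<rangle>\<bar>\<^sup>2\<close> by
  \<open>\<parallel>f\<parallel>\<^sup>2 * \<integral> \<bar>G\<bar>\<^sup>2 * (r / (phi - r)) ^ (2 k)\<close>, which tends to \<open>0\<close>
  (\<open>GPW_orthogonal_arc_coeff\<close>).

  \<^bold>\<open>Sampling.\<close> Applied to the arcs of length \<open>1 / N\<close> around \<open>q / N\<close> for \<open>0 < q < N\<close>, this says that
  \<open>\<Sum> f n * exp (2 \<pi> i q n / N) * s (m - n)\<close> vanishes for these \<open>q\<close>. Combining these relations with
  the sum for \<open>q = 0\<close>, and summing roots of unity over \<open>q\<close> for two choices of weights,
  evaluates that sum as \<open>N * f m\<close> and turns it into the sum over the multiples of \<open>N\<close>; this is the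
  pointwise formula (\<open>GPW_sampling_pointwise\<close>). Finally, the sequences \<open>m \<mapsto> s (m - N * j)\<close> satisfy a
  Bessel-type bound, again from Bessel's inequality (\<open>synthesis_bound\<close>), and this
  upgrades pointwise convergence to convergence in norm (\<open>synthesis_ell2_has_sum\<close>).
\<close>

section \<open>The sequence space\<close>

lemma ell2_add:
  assumes "f \<in> ell2" "g \<in> ell2"
  shows "(\<lambda>n. f n + g n) \<in> ell2"
proof -
  have le: "(cmod (f n + g n))\<^sup>2 \<le> 2 * (cmod (f n))\<^sup>2 + 2 * (cmod (g n))\<^sup>2" for n
  proof -
    have "(cmod (f n + g n))\<^sup>2 \<le> (cmod (f n) + cmod (g n))\<^sup>2"
      by (intro power_mono norm_triangle_ineq) auto
    also have "\<dots> \<le> 2 * (cmod (f n))\<^sup>2 + 2 * (cmod (g n))\<^sup>2"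
      using sum_squares_bound[of "cmod (f n)" "cmod (g n)"] by (simp add: power2_sum)
    finally show ?thesis .
  qed
  have "(\<lambda>n. 2 * (cmod (f n))\<^sup>2 + 2 * (cmod (g n))\<^sup>2) summable_on UNIV"
    using assms unfolding ell2_def by (intro summable_on_add summable_on_cmult_right) auto
  then show ?thesis
    unfolding ell2_def mem_Collect_eq by (rule summable_on_comparison_test) (use le in auto)
qed

lemma ell2_scale: "f \<in> ell2 \<Longrightarrow> (\<lambda>n. c * f n) \<in> ell2"
  unfolding ell2_def by (auto simp: norm_mult power_mult_distrib intro: summable_on_cmult_right)

lemma ell2_diff: "f \<in> ell2 \<Longrightarrow> g \<in> ell2 \<Longrightarrow> (\<lambda>n. f n - g n) \<in> ell2"
  using ell2_add[of f "\<lambda>n. (-1) * g n"] ell2_scale[of g "-1"] by simp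

lemma ell2_zero: "(\<lambda>n. 0) \<in> ell2"
  unfolding ell2_def by simp

lemma ell2_sum:
  assumes "\<And>i. i \<in> F \<Longrightarrow> g i \<in> ell2"
  shows "(\<lambda>n. \<Sum>i\<in>F. g i n) \<in> ell2"
  using assms by (induction F rule: infinite_finite_induct) (auto intro: ell2_zero ell2_add)

lemma ell2_shift:
  assumes "f \<in> ell2" shows "(\<lambda>n. f (n + k)) \<in> ell2"
proof -
  have "bij_betw (\<lambda>n. n + k) UNIV (UNIV :: int set)"
    by (rule bij_betw_byWitness[where f' = "\<lambda>n. n - k"]) auto
  then show ?thesis
    using assms summable_on_reindex_bij_betw[of "\<lambda>n. n + k" UNIV UNIV "\<lambda>n. (cmod (f n))\<^sup>2"]
    unfolding ell2_def by simp
qed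

lemma ell2_norm_nonneg: "ell2_norm f \<ge> 0"
  unfolding ell2_norm_def by (simp add: infsum_nonneg)

lemma ell2_norm_sq: "(ell2_norm f)\<^sup>2 = (\<Sum>\<^sub>\<infinity>n. (cmod (f n))\<^sup>2)"
  unfolding ell2_norm_def by (simp add: infsum_nonneg)

lemma finite_sum_le_ell2_norm:
  assumes "f \<in> ell2" "finite F"
  shows "(\<Sum>n\<in>F. (cmod (f n))\<^sup>2) \<le> (ell2_norm f)\<^sup>2"
  unfolding ell2_norm_sq using assms
  by (intro finite_sum_le_infsum) (auto simp: ell2_def)

text \<open>Uniformly bounded finite partial sums give both membership and the norm bound; every sequence
  shown to be square-summable by a Bessel-type estimate enters \<open>ell2\<close> this way.\<close>

lemma ell2I_bounded:
  assumes "\<And>F. finite F \<Longrightarrow> (\<Sum>n\<in>F. (cmod (f n))\<^sup>2) \<le> B"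
  shows "f \<in> ell2" "(ell2_norm f)\<^sup>2 \<le> B"
proof -
  have *: "(\<lambda>n. (cmod (f n))\<^sup>2) summable_on UNIV"
    by (rule nonneg_bounded_partial_sums_imp_summable_on[where C = B])
       (auto intro!: eventually_finite_subsets_at_top_weakI assms)
  then show "f \<in> ell2" by (simp add: ell2_def)
  show "(ell2_norm f)\<^sup>2 \<le> B"
    unfolding ell2_norm_sq using * assms by (intro infsum_le_finite_sums) auto
qed

lemma ell2_norm_eq_0:
  assumes "f \<in> ell2" "ell2_norm f = 0" shows "f n = 0"
  using finite_sum_le_ell2_norm[OF assms(1), of "{n}"] assms(2) by simp

lemma ell2_sum_mult_le:
  assumes "f \<in> ell2" "g \<in> ell2" "finite F"
  shows "(\<Sum>n\<in>F. cmod (f n * cnj (g n))) \<le> ell2_norm f * ell2_norm g"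
proof -
  have "(\<Sum>n\<in>F. cmod (f n * cnj (g n))) = (\<Sum>n\<in>F. \<bar>cmod (f n)\<bar> * \<bar>cmod (g n)\<bar>)"
    by (simp add: norm_mult)
  also have "\<dots> \<le> L2_set (\<lambda>n. cmod (f n)) F * L2_set (\<lambda>n. cmod (g n)) F"
    by (rule L2_set_mult_ineq)
  also have "\<dots> \<le> ell2_norm f * ell2_norm g"
    unfolding L2_set_def using finite_sum_le_ell2_norm assms
    by (intro mult_mono real_le_lsqrt ell2_norm_nonneg) (auto intro!: real_sqrt_ge_zero sum_nonneg)
  finally show ?thesis .
qed

lemma ell2_mult_abs_summable:
  assumes "f \<in> ell2" "g \<in> ell2"
  shows "(\<lambda>n. norm (f n * cnj (g n))) summable_on UNIV"
  by (rule nonneg_bounded_partial_sums_imp_summable_on[where C = "ell2_norm f * ell2_norm g"])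
     (auto intro!: eventually_finite_subsets_at_top_weakI ell2_sum_mult_le assms)

lemma ell2_inner_has_sum:
  assumes "f \<in> ell2" "g \<in> ell2"
  shows "((\<lambda>n. f n * cnj (g n)) has_sum ell2_inner f g) UNIV"
  unfolding ell2_inner_def
  using abs_summable_summable[OF ell2_mult_abs_summable[OF assms]] by (rule has_sum_infsum)

lemma ell2_inner_eqI:
  "((\<lambda>n. f n * cnj (g n)) has_sum s) UNIV \<Longrightarrow> ell2_inner f g = s"
  unfolding ell2_inner_def by (rule infsumI)

lemma ell2_Cauchy_Schwarz:
  assumes "f \<in> ell2" "g \<in> ell2"
  shows "cmod (ell2_inner f g) \<le> ell2_norm f * ell2_norm g"
proof -
  have "cmod (ell2_inner f g) \<le> (\<Sum>\<^sub>\<infinity>n. cmod (f n * cnj (g n)))"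
    unfolding ell2_inner_def by (rule norm_infsum_bound[OF ell2_mult_abs_summable[OF assms]])
  also have "\<dots> \<le> ell2_norm f * ell2_norm g"
    using ell2_sum_mult_le[OF assms] ell2_mult_abs_summable[OF assms]
    by (intro infsum_le_finite_sums) auto
  finally show ?thesis .
qed

lemma ell2_inner_add_left:
  assumes "f \<in> ell2" "g \<in> ell2" "h \<in> ell2"
  shows "ell2_inner (\<lambda>n. f n + g n) h = ell2_inner f h + ell2_inner g h"
  using has_sum_add[OF ell2_inner_has_sum[OF assms(1,3)] ell2_inner_has_sum[OF assms(2,3)]]
  by (intro ell2_inner_eqI) (simp add: algebra_simps)

lemma ell2_inner_scale_left:
  "ell2_inner (\<lambda>n. c * f n) h = c * ell2_inner f h"
  unfolding ell2_inner_def by (simp add: mult.assoc infsum_cmult_right')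

lemma ell2_inner_diff_left:
  assumes "f \<in> ell2" "g \<in> ell2" "h \<in> ell2"
  shows "ell2_inner (\<lambda>n. f n - g n) h = ell2_inner f h - ell2_inner g h"
  using ell2_inner_add_left[OF assms(1) ell2_scale[OF assms(2), of "-1"] assms(3)]
  by (simp only: ell2_inner_scale_left) simp

lemma ell2_inner_sum_left:
  assumes "\<And>i. i \<in> F \<Longrightarrow> g i \<in> ell2" "h \<in> ell2"
  shows "ell2_inner (\<lambda>n. \<Sum>i\<in>F. g i n) h = (\<Sum>i\<in>F. ell2_inner (g i) h)"
  using assms(1)
  by (induction F rule: infinite_finite_induct)
     (auto simp: ell2_inner_add_left ell2_sum assms(2), auto simp: ell2_inner_def)

lemma ell2_inner_cnj: "ell2_inner g f = cnj (ell2_inner f g)"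
  unfolding ell2_inner_def by (simp flip: infsum_cnj add: mult.commute)

lemma ell2_inner_add_right:
  assumes "f \<in> ell2" "g \<in> ell2" "h \<in> ell2"
  shows "ell2_inner h (\<lambda>n. f n + g n) = ell2_inner h f + ell2_inner h g"
  using ell2_inner_add_left[OF assms] ell2_inner_cnj by (metis complex_cnj_add)

lemma ell2_inner_diff_right:
  assumes "f \<in> ell2" "g \<in> ell2" "h \<in> ell2"
  shows "ell2_inner h (\<lambda>n. f n - g n) = ell2_inner h f - ell2_inner h g"
  using ell2_inner_diff_left[OF assms] ell2_inner_cnj by (metis complex_cnj_diff)

lemma ell2_inner_scale_right:
  "ell2_inner h (\<lambda>n. c * f n) = cnj c * ell2_inner h f"
  using ell2_inner_scale_left[of c f h] ell2_inner_cnj by (metis complex_cnj_mult)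

lemma ell2_inner_self:
  assumes "f \<in> ell2"
  shows "ell2_inner f f = complex_of_real ((ell2_norm f)\<^sup>2)"
proof (rule ell2_inner_eqI)
  have "((\<lambda>n. (cmod (f n))\<^sup>2) has_sum (ell2_norm f)\<^sup>2) UNIV"
    unfolding ell2_norm_sq using assms by (intro has_sum_infsum) (simp add: ell2_def)
  then show "((\<lambda>n. f n * cnj (f n)) has_sum complex_of_real ((ell2_norm f)\<^sup>2)) UNIV"
    unfolding complex_norm_square[symmetric] has_sum_of_real_iff .
qed

section \<open>Projection-valued measures\<close>

locale ell2_pvm =
  fixes E :: "real set \<Rightarrow> (int \<Rightarrow> complex) \<Rightarrow> (int \<Rightarrow> complex)"
  assumes pvm: "projection_valued_measure E"
begin

lemma E_projection: "A \<in> sets borel \<Longrightarrow> ell2_projection (E A)"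
  using pvm by (simp add: projection_valued_measure_def)

lemma E_closed: "A \<in> sets borel \<Longrightarrow> f \<in> ell2 \<Longrightarrow> E A f \<in> ell2"
  using E_projection[of A] by (simp add: ell2_projection_def)

lemma E_linear:
  "A \<in> sets borel \<Longrightarrow> f \<in> ell2 \<Longrightarrow> g \<in> ell2 \<Longrightarrow>
    E A (\<lambda>n. a * f n + b * g n) = (\<lambda>n. a * E A f n + b * E A g n)"
  using E_projection[of A] by (simp add: ell2_projection_def)

lemma E_idem: "A \<in> sets borel \<Longrightarrow> f \<in> ell2 \<Longrightarrow> E A (E A f) = E A f"
  using E_projection[of A] by (simp add: ell2_projection_def)

lemma E_self_adjoint:
  "A \<in> sets borel \<Longrightarrow> f \<in> ell2 \<Longrightarrow> g \<in> ell2 \<Longrightarrow> ell2_inner (E A f) g = ell2_inner f (E A g)"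
  using E_projection[of A] by (simp add: ell2_projection_def)

lemma E_UNIV: "f \<in> ell2 \<Longrightarrow> E UNIV f = f"
  using pvm by (simp add: projection_valued_measure_def)

lemma E_Int:
  "A \<in> sets borel \<Longrightarrow> B \<in> sets borel \<Longrightarrow> f \<in> ell2 \<Longrightarrow> E (A \<inter> B) f = E A (E B f)"
  using pvm by (simp add: projection_valued_measure_def)

lemma E_diag_eq_norm:
  assumes "A \<in> sets borel" "f \<in> ell2"
  shows "Re (ell2_inner (E A f) f) = (ell2_norm (E A f))\<^sup>2"
proof -
  have "ell2_inner (E A f) f = ell2_inner (E A (E A f)) f"
    using assms by (simp add: E_idem)
  also have "\<dots> = ell2_inner (E A f) (E A f)"
    using assms by (intro E_self_adjoint E_closed)
  finally show ?thesis using assms by (simp add: ell2_inner_self E_closed)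
qed

text \<open>Norm convergence of the projections \<open>E (A i) f\<close> passes to the diagonal matrix elements because
  the inner product is norm-continuous; this is what makes the scalar spectral measure countably
  additive.\<close>

lemma E_diag_has_sum:
  fixes A :: "nat \<Rightarrow> real set"
  assumes "range A \<subseteq> sets borel" "disjoint_family A" "f \<in> ell2"
  shows "((\<lambda>i. Re (ell2_inner (E (A i) f) f)) has_sum Re (ell2_inner (E (\<Union>i. A i) f) f)) UNIV"
proof -
  have A: "A i \<in> sets borel" "(\<Union>i. A i) \<in> sets borel" for i
    using assms(1) by auto
  have hs: "ell2_has_sum (\<lambda>i. E (A i) f) UNIV (E (\<Union>i. A i) f)"
    using pvm assms by (simp add: projection_valued_measure_def)
  let ?r = "\<lambda>F n. E (\<Union>i. A i) f n - (\<Sum>i\<in>F. E (A i) f n)"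
  have lim: "((\<lambda>F. ell2_norm (?r F) * ell2_norm f) \<longlongrightarrow> 0) (finite_subsets_at_top UNIV)"
    using hs unfolding ell2_has_sum_def by (auto intro: tendsto_mult_left_zero)
  have "((\<lambda>F. Re (ell2_inner (E (\<Union>i. A i) f) f) - (\<Sum>i\<in>F. Re (ell2_inner (E (A i) f) f)))
          \<longlongrightarrow> 0) (finite_subsets_at_top UNIV)"
  proof (rule Lim_null_comparison[OF _ lim], intro always_eventually allI)
    fix F :: "nat set"
    have "Re (ell2_inner (E (\<Union>i. A i) f) f) - (\<Sum>i\<in>F. Re (ell2_inner (E (A i) f) f))
          = Re (ell2_inner (?r F) f)"
      using A assms(3) by (simp add: ell2_inner_diff_left ell2_inner_sum_left ell2_sum E_closed)
    also have "\<bar>\<dots>\<bar> \<le> cmod (ell2_inner (?r F) f)" by (rule abs_Re_le_cmod)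
    also have "\<dots> \<le> ell2_norm (?r F) * ell2_norm f"
      using A assms(3) by (intro ell2_Cauchy_Schwarz ell2_diff ell2_sum E_closed)
    finally show "norm (Re (ell2_inner (E (\<Union>i. A i) f) f)
        - (\<Sum>i\<in>F. Re (ell2_inner (E (A i) f) f))) \<le> ell2_norm (?r F) * ell2_norm f" by simp
  qed
  from tendsto_diff[OF tendsto_const[of "Re (ell2_inner (E (\<Union>i. A i) f) f)"] this]
  show ?thesis unfolding has_sum_def by simp
qed

text \<open>The constant family of empty sets is disjoint, so its constant diagonal values form a convergent
  series.\<close>

lemma E_empty_diag:
  assumes "f \<in> ell2" shows "Re (ell2_inner (E {} f) f) = 0"
proof -
  have "(\<lambda>i::nat. Re (ell2_inner (E {} f) f)) sums Re (ell2_inner (E (\<Union>i::nat. {}) f) f)"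
    by (intro has_sum_imp_sums E_diag_has_sum assms) (auto simp: disjoint_family_on_def)
  then show ?thesis by (auto dest!: sums_summable simp: summable_const_iff)
qed

text \<open>The constant \<open>measure_of\<close> returns the null measure unless the given set function is a measure,
  so positivity and countable additivity have to be established before any value can be read
  off.\<close>

lemma emeasure_scalar_spectral:
  assumes "f \<in> ell2" "A \<in> sets borel"
  shows "emeasure (scalar_spectral_measure E f) A = ennreal (Re (ell2_inner (E A f) f))"
proof -
  let ?\<mu> = "\<lambda>A. ennreal (Re (ell2_inner (E A f) f))"
  show ?thesis
    unfolding scalar_spectral_measure_def
  proof (rule emeasure_measure_of_sigma[OF _ _ _ assms(2)])
    show "sigma_algebra UNIV (sets borel :: real set set)"
      using sets.sigma_algebra_axioms[of "borel :: real measure"] by simp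
    show "positive (sets borel) ?\<mu>"
      using assms(1) by (simp add: positive_def E_empty_diag)
    show "countably_additive (sets borel) ?\<mu>"
    proof (rule countably_additiveI)
      fix A :: "nat \<Rightarrow> real set"
      assume A: "range A \<subseteq> sets borel" "disjoint_family A" "(\<Union>i. A i) \<in> sets borel"
      have "0 \<le> Re (ell2_inner (E (A i) f) f)" for i
        using A(1) assms(1) by (subst E_diag_eq_norm) auto
      moreover have "(\<lambda>i. Re (ell2_inner (E (A i) f) f)) sums Re (ell2_inner (E (\<Union>i. A i) f) f)"
        by (intro has_sum_imp_sums E_diag_has_sum A assms)
      ultimately show "(\<Sum>i. ?\<mu> (A i)) = ?\<mu> (\<Union> (range A))"
        by (intro suminf_ennreal_eq)
    qed
  qed
qed

lemma sets_scalar_spectral [simp, measurable_cong]: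
  "sets (scalar_spectral_measure E f) = sets borel"
  unfolding scalar_spectral_measure_def
  using sets.sigma_sets_eq[of "borel :: real measure"] by (simp add: sets_measure_of)

lemma space_scalar_spectral [simp]: "space (scalar_spectral_measure E f) = UNIV"
  by (simp add: scalar_spectral_measure_def space_measure_of_conv)

text \<open>Restricting the spectral measure of \<open>f\<close> to \<open>A\<close> amounts to projecting \<open>f\<close>, because
  \<open>\<langle>E (A \<inter> B) f, f\<rangle> = \<langle>E B (E A f), E A f\<rangle>\<close>. Restriction to \<open>A\<close> is expressed as a density so that
  integrals transfer.\<close>

lemma density_scalar_spectral:
  assumes "f \<in> ell2" "A \<in> sets borel"
  shows "density (scalar_spectral_measure E f) (\<lambda>x. ennreal (indicator A x))
         = scalar_spectral_measure E (E A f)"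
proof (rule measure_eqI)
  fix B assume "B \<in> sets (density (scalar_spectral_measure E f) (\<lambda>x. ennreal (indicator A x)))"
  then have B: "B \<in> sets borel" by simp
  have "emeasure (density (scalar_spectral_measure E f) (\<lambda>x. ennreal (indicator A x))) B
        = (\<integral>\<^sup>+x. ennreal (indicator A x) * indicator B x \<partial>scalar_spectral_measure E f)"
    using assms(2) B by (intro emeasure_density) auto
  also have "\<dots> = (\<integral>\<^sup>+x. indicator (A \<inter> B) x \<partial>scalar_spectral_measure E f)"
    by (intro nn_integral_cong) (auto simp: indicator_def)
  also have "\<dots> = ennreal (Re (ell2_inner (E (A \<inter> B) f) f))"
    using assms B by (simp add: emeasure_scalar_spectral)
  also have "ell2_inner (E (A \<inter> B) f) f = ell2_inner (E (A \<inter> B) (E A f)) (E A f)"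
  proof -
    have "ell2_inner (E (A \<inter> B) f) f = ell2_inner (E A (E (B \<inter> A) f)) f"
      using assms B by (subst E_Int[symmetric]) (auto simp: Int_ac)
    also have "\<dots> = ell2_inner (E B (E A f)) (E A f)"
      using assms B by (subst E_self_adjoint) (auto simp: E_closed E_Int)
    also have "E B (E A f) = E (A \<inter> B) (E A f)"
      using assms B by (subst Int_commute) (simp add: E_Int E_closed E_idem)
    finally show ?thesis .
  qed
  also have "E (A \<inter> B) (E A f) = E B (E A f)"
    using assms B by (subst Int_commute) (simp add: E_Int E_closed E_idem)
  finally show "emeasure (density (scalar_spectral_measure E f) (\<lambda>x. ennreal (indicator A x))) B
      = emeasure (scalar_spectral_measure E (E A f)) B"
    using assms B by (simp add: emeasure_scalar_spectral E_closed)
qed simp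

lemma E_empty:
  assumes "f \<in> ell2" shows "E {} f = (\<lambda>n. 0)"
proof -
  have "(ell2_norm (E {} f))\<^sup>2 = 0"
    using E_empty_diag[OF assms] assms by (simp add: E_diag_eq_norm)
  then show ?thesis using assms by (intro ext ell2_norm_eq_0 E_closed) auto
qed

text \<open>Finite additivity of the spectral measure gives \<open>\<parallel>E (- A) u\<parallel> = \<parallel>u\<parallel>\<close>, and an orthogonal
  projection that preserves the norm of a vector fixes it.\<close>

lemma E_Compl_of_kernel:
  assumes A: "A \<in> sets borel" and u: "u \<in> ell2" "E A u = (\<lambda>n. 0)"
  shows "E (- A) u = u"
proof -
  have nA: "- A \<in> sets borel" using A by auto
  have "emeasure (scalar_spectral_measure E u) A + emeasure (scalar_spectral_measure E u) (- A)
        = emeasure (scalar_spectral_measure E u) UNIV"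
    using A nA by (subst plus_emeasure) auto
  moreover have "emeasure (scalar_spectral_measure E u) A = 0"
    using A u by (simp add: emeasure_scalar_spectral ell2_inner_def)
  ultimately have "Re (ell2_inner (E (- A) u) u) = Re (ell2_inner u u)"
    using nA u(1) by (simp add: emeasure_scalar_spectral E_diag_eq_norm E_UNIV ell2_inner_self)
  moreover define w where "w = (\<lambda>n. u n - E (- A) u n)"
  have w: "w \<in> ell2" unfolding w_def using nA u by (intro ell2_diff E_closed)
  ultimately have wu: "Re (ell2_inner w u) = 0"
    using nA u(1) by (simp add: w_def ell2_inner_diff_left E_closed)
  have Ew: "E (- A) w = (\<lambda>n. 0)"
    using E_linear[OF nA u(1) E_closed[OF nA u(1)], of 1 "-1"] nA u(1) by (simp add: w_def E_idem)
  have "ell2_inner w w = ell2_inner w u - ell2_inner w (E (- A) u)"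
    using nA u(1) w by (subst (2) w_def) (simp add: ell2_inner_diff_right E_closed)
  also have "ell2_inner w (E (- A) u) = ell2_inner (E (- A) w) u"
    using nA u(1) w by (simp add: E_self_adjoint)
  also have "\<dots> = 0" by (simp add: Ew ell2_inner_def)
  finally have "Re (ell2_inner w w) = 0" using wu by simp
  then have "ell2_norm w = 0" using w by (simp add: ell2_inner_self)
  with w have "w n = 0" for n by (rule ell2_norm_eq_0)
  then show ?thesis by (auto simp: w_def)
qed

end

section \<open>Spectral subspaces of an operator with a spectral measure\<close>

locale ell2_spectral = ell2_pvm E
  for E :: "real set \<Rightarrow> (int \<Rightarrow> complex) \<Rightarrow> (int \<Rightarrow> complex)" +
  fixes T :: "(int \<Rightarrow> complex) \<Rightarrow> (int \<Rightarrow> complex)"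
  assumes spectral: "is_spectral_measure T E"
    and T_closed: "f \<in> ell2 \<Longrightarrow> T f \<in> ell2"
    and T_linear: "f \<in> ell2 \<Longrightarrow> g \<in> ell2 \<Longrightarrow>
          T (\<lambda>n. a * f n + b * g n) = (\<lambda>n. a * T f n + b * T g n)"
begin

lemma form_eq_integral:
  assumes "f \<in> ell2"
  shows "integrable (scalar_spectral_measure E f) (\<lambda>x. x)"
    "ell2_inner (T f) f = complex_of_real (\<integral>x. x \<partial>scalar_spectral_measure E f)"
  using spectral assms unfolding is_spectral_measure_def by auto

lemma form_E:
  assumes "f \<in> ell2" "A \<in> sets borel"
  shows "ell2_inner (T (E A f)) (E A f)
    = complex_of_real (\<integral>x. indicator A x * x \<partial>scalar_spectral_measure E f)"
proof -
  have "(\<integral>x. x \<partial>scalar_spectral_measure E (E A f))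
        = (\<integral>x. x \<partial>density (scalar_spectral_measure E f) (\<lambda>x. ennreal (indicator A x)))"
    by (simp only: density_scalar_spectral[OF assms])
  also have "\<dots> = (\<integral>x. indicator A x *\<^sub>R x \<partial>scalar_spectral_measure E f)"
    using assms(2) by (intro integral_density) auto
  finally show ?thesis
    using form_eq_integral(2)[OF E_closed[OF assms(2,1)]] by simp
qed

text \<open>The integral of \<open>x\<close> splits over \<open>A\<close> and its complement, and each part is the form of a projected
  vector.\<close>

lemma form_split:
  assumes "f \<in> ell2" "A \<in> sets borel"
  shows "ell2_inner (T f) f = ell2_inner (T (E A f)) (E A f)
          + ell2_inner (T (E (- A) f)) (E (- A) f)"
proof -
  let ?M = "scalar_spectral_measure E f"
  have nA: "- A \<in> sets borel" using assms(2) by auto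
  have int: "integrable ?M (\<lambda>x. indicator B x * x)" if "B \<in> sets borel" for B
    using integrable_mult_indicator[OF _ form_eq_integral(1)[OF assms(1)], of B] that by simp
  have "(\<integral>x. x \<partial>?M) = (\<integral>x. indicator A x * x + indicator (- A) x * x \<partial>?M)"
    by (intro Bochner_Integration.integral_cong) (auto simp: indicator_def)
  also have "\<dots> = (\<integral>x. indicator A x * x \<partial>?M) + (\<integral>x. indicator (- A) x * x \<partial>?M)"
    by (intro Bochner_Integration.integral_add int assms(2) nA)
  finally show ?thesis
    using form_E[OF assms] form_E[OF assms(1) nA] form_eq_integral(2)[OF assms(1)] by simp
qed

text \<open>For \<open>u\<close> in the range and \<open>w\<close> in the kernel of \<open>E A\<close> the splitting of the form of \<open>u + w\<close> leaves
  no room for cross terms, \<open>\<langle>T u, w\<rangle> + \<langle>T w, u\<rangle> = 0\<close>. Taking \<open>w = v\<close> and \<open>w = \<i> v\<close> separates the two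
  terms.\<close>

lemma T_orthogonal:
  assumes A: "A \<in> sets borel" and u: "u \<in> ell2" "E A u = u"
    and v: "v \<in> ell2" "E A v = (\<lambda>n. 0)"
  shows "ell2_inner (T u) v = 0"
proof -
  have nA: "- A \<in> sets borel" using A by auto
  have cross: "ell2_inner (T u) w + ell2_inner (T w) u = 0"
    if w: "w \<in> ell2" "E A w = (\<lambda>n. 0)" for w
  proof -
    let ?s = "\<lambda>n. u n + w n"
    have s: "?s \<in> ell2" using u w by (intro ell2_add)
    have 1: "E A ?s = u"
      using E_linear[OF A u(1) w(1), of 1 1] u w by simp
    have "E (- A) u = E (- A \<inter> A) u" using A nA u by (subst E_Int) auto
    then have "E (- A) u = (\<lambda>n. 0)" using E_empty[OF u(1)] by simp
    then have 2: "E (- A) ?s = w"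
      using E_linear[OF nA u(1) w(1), of 1 1] E_Compl_of_kernel[OF A w] by simp
    have "T ?s = (\<lambda>n. T u n + T w n)" using T_linear[OF u(1) w(1), of 1 1] by simp
    then have "ell2_inner (T ?s) ?s = ell2_inner (T u) u + ell2_inner (T u) w
        + ell2_inner (T w) u + ell2_inner (T w) w"
      using u w by (simp add: ell2_inner_add_left ell2_inner_add_right ell2_add T_closed)
    then show ?thesis using form_split[OF s A] unfolding 1 2 by simp
  qed
  let ?w = "\<lambda>n. \<i> * v n"
  have "E A ?w = (\<lambda>n. 0)" using E_linear[OF A v(1) v(1), of "\<i>" 0] v by simp
  then have "ell2_inner (T u) ?w + ell2_inner (T ?w) u = 0" using v by (intro cross ell2_scale)
  moreover have "T ?w = (\<lambda>n. \<i> * T v n)" using T_linear[OF v(1) v(1), of "\<i>" 0] by simp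
  ultimately have "- \<i> * ell2_inner (T u) v + \<i> * ell2_inner (T v) u = 0"
    by (simp add: ell2_inner_scale_left ell2_inner_scale_right)
  moreover have "ell2_inner (T v) u = - ell2_inner (T u) v"
    using cross[OF v] by (simp add: eq_neg_iff_add_eq_0 add.commute)
  ultimately show ?thesis by simp
qed

text \<open>The component \<open>v\<close> of \<open>T u\<close> in the kernel of \<open>E A\<close> satisfies \<open>\<langle>v, v\<rangle> = \<langle>T u, v\<rangle> = 0\<close>.\<close>

lemma T_invariant:
  assumes A: "A \<in> sets borel" and u: "u \<in> ell2" "E A u = u"
  shows "E A (T u) = T u"
proof -
  define v where "v = (\<lambda>n. T u n - E A (T u) n)"
  note Tu = T_closed[OF u(1)] and PTu = E_closed[OF A T_closed[OF u(1)]]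
  have v: "v \<in> ell2" unfolding v_def using Tu PTu by (rule ell2_diff)
  have Ev: "E A v = (\<lambda>n. 0)"
    using E_linear[OF A Tu PTu, of 1 "-1"] A Tu by (simp add: v_def E_idem)
  have "ell2_inner v v = ell2_inner (T u) v - ell2_inner (E A (T u)) v"
    using Tu PTu v by (subst (1) v_def) (simp add: ell2_inner_diff_left)
  also have "ell2_inner (E A (T u)) v = ell2_inner (T u) (E A v)"
    using A Tu v by (rule E_self_adjoint)
  also have "\<dots> = 0" by (simp add: Ev ell2_inner_def)
  also have "ell2_inner (T u) v = 0" by (rule T_orthogonal[OF A u v Ev])
  finally have "ell2_norm v = 0" using v by (simp add: ell2_inner_self)
  with v have "v n = 0" for n by (rule ell2_norm_eq_0)
  then show ?thesis by (auto simp: v_def)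
qed

text \<open>The spectral measure of \<open>u\<close> gives \<open>{a..b}\<close> its full mass, so the form of \<open>u\<close> is the integral
  of a variable confined to \<open>{a..b}\<close>.\<close>

lemma form_bounds:
  assumes u: "u \<in> ell2" "E {a..b} u = u"
  shows "a * (ell2_norm u)\<^sup>2 \<le> Re (ell2_inner (T u) u)"
    "Re (ell2_inner (T u) u) \<le> b * (ell2_norm u)\<^sup>2"
proof -
  let ?M = "scalar_spectral_measure E u"
  have em: "emeasure ?M {a..b} = ennreal ((ell2_norm u)\<^sup>2)"
      "emeasure ?M UNIV = ennreal ((ell2_norm u)\<^sup>2)"
    using u by (simp_all add: emeasure_scalar_spectral E_UNIV ell2_inner_self)
  interpret finite_measure ?M
    by (rule finite_measureI) (simp add: em)
  have ms: "measure ?M UNIV = (ell2_norm u)\<^sup>2" using em by (simp add: measure_def)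
  have "emeasure ?M (UNIV - {a..b}) = 0"
    using em by (subst emeasure_Diff) auto
  then have ae: "AE x in ?M. x \<in> {a..b}"
    by (intro AE_I[of _ _ "UNIV - {a..b}"]) auto
  have "(\<integral>x. a \<partial>?M) \<le> (\<integral>x. x \<partial>?M)"
    using ae form_eq_integral[OF u(1)] by (intro integral_mono_AE) auto
  moreover have "(\<integral>x. x \<partial>?M) \<le> (\<integral>x. b \<partial>?M)"
    using ae form_eq_integral[OF u(1)] by (intro integral_mono_AE) auto
  ultimately show "a * (ell2_norm u)\<^sup>2 \<le> Re (ell2_inner (T u) u)"
    "Re (ell2_inner (T u) u) \<le> b * (ell2_norm u)\<^sup>2"
    using form_eq_integral(2)[OF u(1)] ms by (simp_all add: mult.commute)
qed

text \<open>The form of \<open>S = T - r\<close> is bounded by \<open>r\<close> in modulus on the spectral subspace of \<open>{0..2 * r}\<close>. For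
  a self-adjoint operator on an invariant subspace this bounds the operator itself, by polarising
  \<open>\<langle>S u, S u\<rangle>\<close>.\<close>

lemma centred_contraction:
  assumes u: "u \<in> ell2" "E {0..2 * r} u = u" and r: "r > 0"
    and sa: "\<And>f g. f \<in> ell2 \<Longrightarrow> g \<in> ell2 \<Longrightarrow> ell2_inner (T f) g = ell2_inner f (T g)"
  shows "ell2_norm (\<lambda>n. T u n - complex_of_real r * u n) \<le> r * ell2_norm u"
proof -
  let ?A = "{0..2 * r}"
  define S where "S = (\<lambda>f n. T f n - complex_of_real r * f n)"
  have A: "?A \<in> sets borel" by simp
  have Scl: "S f \<in> ell2" if "f \<in> ell2" for f
    unfolding S_def using that by (intro ell2_diff ell2_scale T_closed)
  have Slin: "S (\<lambda>n. f n + c * g n) = (\<lambda>n. S f n + c * S g n)"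
    if "f \<in> ell2" "g \<in> ell2" for f g c
    using T_linear[OF that, of 1 c] by (auto simp: S_def algebra_simps)
  have Ssa: "ell2_inner (S f) g = ell2_inner f (S g)" if "f \<in> ell2" "g \<in> ell2" for f g
    using that unfolding S_def
    by (simp add: ell2_inner_diff_left ell2_inner_diff_right ell2_scale T_closed
        ell2_inner_scale_left ell2_inner_scale_right sa)
  have form: "\<bar>Re (ell2_inner (S f) f)\<bar> \<le> r * (ell2_norm f)\<^sup>2" if "f \<in> ell2" "E ?A f = f" for f
  proof -
    have "Re (ell2_inner (S f) f) = Re (ell2_inner (T f) f) - r * (ell2_norm f)\<^sup>2"
      using that unfolding S_def
      by (simp add: ell2_inner_diff_left ell2_scale T_closed ell2_inner_scale_left ell2_inner_self)
    then show ?thesis using form_bounds[OF that] by (simp add: abs_le_iff)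
  qed
  define v where "v = (\<lambda>n. S u n)"
  have v: "v \<in> ell2" "E ?A v = v"
    using Scl[OF u(1)] E_linear[OF A T_closed[OF u(1)] u(1), of 1 "- complex_of_real r"]
      T_invariant[OF A u] u by (simp_all add: v_def S_def)
  \<comment> \<open>Add the upper form bound at \<open>u + c v\<close> to the lower one at \<open>u - c v\<close>, where \<open>v = S u\<close>: the left
    side is what remains of the cross terms, the right side comes from the parallelogram law.\<close>
  have pol: "2 * c * (ell2_norm v)\<^sup>2 * 2 \<le> r * (2 * (ell2_norm u)\<^sup>2 + 2 * c\<^sup>2 * (ell2_norm v)\<^sup>2)" for c :: real
  proof -
    have form': "Re (ell2_inner (S (\<lambda>n. u n + complex_of_real d * v n)) (\<lambda>n. u n + complex_of_real d * v n))
        = Re (ell2_inner (S u) u) + 2 * d * (ell2_norm v)\<^sup>2 + d\<^sup>2 * Re (ell2_inner (S v) v)" for d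
    proof -
      have "ell2_inner (S v) u = ell2_inner v v" using Ssa[OF v(1) u(1)] by (simp add: v_def)
      moreover have "ell2_inner (S u) v = ell2_inner v v" by (simp add: v_def)
      ultimately show ?thesis using u v
        by (simp add: Slin ell2_inner_add_left ell2_inner_add_right ell2_add ell2_scale Scl
          ell2_inner_scale_left ell2_inner_scale_right ell2_inner_self power2_eq_square algebra_simps)
    qed
    have norm': "(ell2_norm (\<lambda>n. u n + complex_of_real d * v n))\<^sup>2
        = (ell2_norm u)\<^sup>2 + 2 * d * Re (ell2_inner u v) + d\<^sup>2 * (ell2_norm v)\<^sup>2" for d
    proof -
      have "ell2_inner (\<lambda>n. u n + complex_of_real d * v n) (\<lambda>n. u n + complex_of_real d * v n)
        = ell2_inner u u + d * ell2_inner u v + d * cnj (ell2_inner u v) + d\<^sup>2 * ell2_inner v v"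
        using u v ell2_inner_cnj[of v u]
        by (simp add: ell2_inner_add_left ell2_inner_add_right ell2_add ell2_scale
          ell2_inner_scale_left ell2_inner_scale_right power2_eq_square algebra_simps)
      then have "Re (ell2_inner (\<lambda>n. u n + complex_of_real d * v n) (\<lambda>n. u n + complex_of_real d * v n))
        = Re (ell2_inner u u + d * ell2_inner u v + d * cnj (ell2_inner u v) + d\<^sup>2 * ell2_inner v v)"
        by simp
      then show ?thesis using u v
        by (simp add: ell2_inner_self ell2_add ell2_scale flip: of_real_power)
    qed
    have E': "E ?A (\<lambda>n. u n + complex_of_real d * v n) = (\<lambda>n. u n + complex_of_real d * v n)" for d
      using E_linear[OF A u(1) v(1), of 1 "complex_of_real d"] u v by simp
    have mem: "(\<lambda>n. u n + complex_of_real d * v n) \<in> ell2" for d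
      by (intro ell2_add ell2_scale u v)
    from abs_le_D1[OF form[OF mem[of c] E']] abs_le_D2[OF form[OF mem[of "- c"] E']] show ?thesis
      unfolding form' norm' by (simp add: algebra_simps)
  qed
  \<comment> \<open>For \<open>c = 1 / r\<close> the inequality reads \<open>4 / r * \<parallel>v\<parallel>\<^sup>2 \<le> 2 * r * \<parallel>u\<parallel>\<^sup>2 + 2 / r * \<parallel>v\<parallel>\<^sup>2\<close>.\<close>
  have "(ell2_norm v)\<^sup>2 \<le> (r * ell2_norm u)\<^sup>2"
    using pol[of "1 / r"] r by (simp add: field_simps power2_eq_square)
  then show ?thesis
    using r ell2_norm_nonneg by (auto simp: v_def S_def intro: power2_le_imp_le)
qed

end

section \<open>Fourier coefficients over an arc\<close>

definition unit_char :: "real \<Rightarrow> complex" where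
  "unit_char x = cis (2 * pi * x)"

lemma unit_char_add: "unit_char (x + y) = unit_char x * unit_char y"
  by (simp add: unit_char_def cis_mult ring_distribs)

lemma unit_char_0 [simp]: "unit_char 0 = 1"
  by (simp add: unit_char_def)

lemma unit_char_int [simp]: "unit_char (of_int n) = 1"
  unfolding unit_char_def by (rule cis_multiple_2pi) simp

lemma norm_unit_char [simp]: "cmod (unit_char x) = 1"
  by (simp add: unit_char_def)

lemma cnj_unit_char: "cnj (unit_char x) = unit_char (- x)"
  by (simp add: unit_char_def cis_cnj)

lemma unit_char_power: "unit_char x ^ n = unit_char (of_nat n * x)"
  by (simp add: unit_char_def Complex.DeMoivre mult_ac)

lemma continuous_on_unit_char [continuous_intros]:
  "continuous_on S g \<Longrightarrow> continuous_on S (\<lambda>x. unit_char (g x))"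
  unfolding unit_char_def by (intro continuous_intros)

lemma unit_char_eq_1D:
  assumes "unit_char x = 1" shows "x \<in> \<int>"
proof -
  have "cos (2 * pi * x) = 1" using assms by (simp add: unit_char_def complex_eq_iff)
  then obtain n :: int where "2 * pi * x = of_int n * 2 * pi" by (auto simp: cos_one_2pi_int)
  then have "x = of_int n" by simp
  then show ?thesis by simp
qed

lemma unit_char_has_integral:
  assumes "a \<le> b" "k \<noteq> 0"
  shows "((\<lambda>x. unit_char (k * x)) has_integral
           (unit_char (k * b) - unit_char (k * a)) / (2 * pi * \<i> * k)) {a..b}"
proof -
  define w where "w = 2 * pi * \<i> * k"
  have w: "w \<noteq> 0" using assms(2) by (simp add: w_def)
  have char: "unit_char (k * x) = exp (w * complex_of_real x)" for x
    by (simp add: unit_char_def cis_conv_exp w_def mult_ac)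
  have "((\<lambda>z. exp (w * z) / w) has_field_derivative exp (w * z)) (at z)" for z
    using w by (auto intro!: derivative_eq_intros)
  then have "((\<lambda>x. unit_char (k * x) / w) has_vector_derivative unit_char (k * x))
      (at x within {a..b})" for x
    unfolding char by (rule has_vector_derivative_real_field)
  from fundamental_theorem_of_calculus[OF assms(1) this]
  show ?thesis by (simp add: diff_divide_distrib w_def)
qed

text \<open>The characters with frequencies in \<open>t \<int>\<close> are orthogonal on every interval of length \<open>1 / t\<close>. The
  frequency \<open>t = 1\<close> gives Bessel's inequality, and \<open>t = N\<close> the norm of a cardinal sine
  series.\<close>

lemma trig_poly_norm_has_integral:
  fixes c :: "int \<Rightarrow> complex"
  assumes "t > 0" "finite F"
  shows "((\<lambda>x. (cmod (\<Sum>j\<in>F. c j * unit_char (t * of_int j * x)))\<^sup>2) has_integral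
           (\<Sum>j\<in>F. (cmod (c j))\<^sup>2) / t) {a..a + 1 / t}"
proof -
  have orth: "((\<lambda>x. unit_char (t * of_int (i - j) * x)) has_integral (if i = j then 1 / t else 0))
      {a..a + 1 / t}" for i j
  proof (cases "i = j")
    case True
    then show ?thesis
      using has_integral_const_real[of "1 :: complex" a "a + 1 / t"] assms(1)
      by (simp add: scaleR_conv_of_real)
  next
    case False
    have "t * of_int (i - j) * (a + 1 / t) = t * of_int (i - j) * a + of_int (i - j)"
      using assms(1) by (simp add: field_simps)
    then have "unit_char (t * of_int (i - j) * (a + 1 / t)) = unit_char (t * of_int (i - j) * a)"
      by (simp only: unit_char_add unit_char_int mult_1_right)
    then show ?thesis
      using unit_char_has_integral[of a "a + 1 / t" "t * of_int (i - j)"] assms(1) False by simp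
  qed
  have "((\<lambda>x. \<Sum>i\<in>F. \<Sum>j\<in>F. c i * cnj (c j) * unit_char (t * of_int (i - j) * x)) has_integral
      (\<Sum>i\<in>F. \<Sum>j\<in>F. c i * cnj (c j) * (if i = j then 1 / t else 0))) {a..a + 1 / t}"
    by (intro has_integral_sum has_integral_mult_right orth assms(2))
  moreover have "(\<Sum>i\<in>F. \<Sum>j\<in>F. c i * cnj (c j) * unit_char (t * of_int (i - j) * x))
      = complex_of_real ((cmod (\<Sum>j\<in>F. c j * unit_char (t * of_int j * x)))\<^sup>2)" for x
  proof -
    have "unit_char (t * of_int (i - j) * x)
        = unit_char (t * of_int i * x) * cnj (unit_char (t * of_int j * x))" for i j
      by (simp add: cnj_unit_char flip: unit_char_add) (simp add: algebra_simps)
    then show ?thesis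
      by (simp only: complex_norm_square cnj_sum complex_cnj_mult sum_product) (simp add: mult_ac)
  qed
  moreover have "(\<Sum>i\<in>F. \<Sum>j\<in>F. c i * cnj (c j) * (if i = j then 1 / t else 0))
      = complex_of_real ((\<Sum>j\<in>F. (cmod (c j))\<^sup>2) / t)"
  proof -
    have "c i * cnj (c j) * (if i = j then 1 / t else 0)
        = (if i = j then c i * cnj (c i) / complex_of_real t else 0)" for i j
      by simp
    then show ?thesis
      using assms(2) by (simp add: sum_divide_distrib complex_norm_square del: of_real_power)
  qed
  ultimately have "((\<lambda>x. complex_of_real ((cmod (\<Sum>j\<in>F. c j * unit_char (t * of_int j * x)))\<^sup>2))
      has_integral complex_of_real ((\<Sum>j\<in>F. (cmod (c j))\<^sup>2) / t)) {a..a + 1 / t}"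
    by simp
  from has_integral_Re[OF this] show ?thesis by simp
qed

text \<open>The integral is over \<open>{a..b}\<close> rather than over a full period of a function cut off outside the
  arc, so that \<open>G\<close> need only be continuous on the arc.\<close>

definition arc_coeff :: "real \<Rightarrow> real \<Rightarrow> (real \<Rightarrow> complex) \<Rightarrow> int \<Rightarrow> complex" where
  "arc_coeff a b G n = integral {a..b} (\<lambda>x. G x * unit_char (- (of_int n * x)))"

lemma arc_coeff_has_integral:
  assumes "continuous_on {a..b} G"
  shows "((\<lambda>x. G x * unit_char (- (of_int n * x))) has_integral arc_coeff a b G n) {a..b}"
  unfolding arc_coeff_def
  by (intro integrable_integral integrable_continuous_interval continuous_intros assms)

text \<open>Expand the square of the distance from \<open>G\<close> to the trigonometric polynomial with the coefficients of
  \<open>G\<close> itself. The square of the polynomial is integrated only over a part of a period, which is at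
  most its integral over the whole period.\<close>

lemma Bessel_arc:
  assumes "b \<le> a + 1" "continuous_on {a..b} G" "finite F"
  shows "(\<Sum>n\<in>F. (cmod (arc_coeff a b G n))\<^sup>2) \<le> integral {a..b} (\<lambda>x. (cmod (G x))\<^sup>2)"
proof -
  define c where "c = arc_coeff a b G"
  define P where "P = (\<lambda>x. \<Sum>n\<in>F. c n * unit_char (1 * of_int n * x))"
  let ?N = "\<Sum>n\<in>F. (cmod (c n))\<^sup>2"
  have P: "continuous_on S P" for S
    unfolding P_def by (intro continuous_intros)
  have full: "((\<lambda>x. (cmod (P x))\<^sup>2) has_integral ?N) {a..a + 1}"
    unfolding P_def using trig_poly_norm_has_integral[of 1 F c a] assms(3) by simp
  have "integral {a..b} (\<lambda>x. (cmod (P x))\<^sup>2) \<le> integral {a..a + 1} (\<lambda>x. (cmod (P x))\<^sup>2)"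
    using assms(1) by (intro integral_subset_le integrable_continuous_interval continuous_intros P) auto
  also have "\<dots> = ?N" using full by (rule integral_unique)
  finally have part: "integral {a..b} (\<lambda>x. (cmod (P x))\<^sup>2) \<le> ?N" .
  have "((\<lambda>x. \<Sum>n\<in>F. cnj (c n) * (G x * unit_char (- (of_int n * x)))) has_integral
      (\<Sum>n\<in>F. cnj (c n) * c n)) {a..b}"
    unfolding c_def
    by (intro has_integral_sum has_integral_mult_right arc_coeff_has_integral assms)
  also have "(\<lambda>x. \<Sum>n\<in>F. cnj (c n) * (G x * unit_char (- (of_int n * x)))) = (\<lambda>x. G x * cnj (P x))"
    by (simp add: P_def sum_distrib_left cnj_unit_char mult_ac)
  also have "(\<Sum>n\<in>F. cnj (c n) * c n) = complex_of_real ?N"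
    by (simp add: complex_norm_square mult.commute flip: of_real_power)
  finally have cross: "((\<lambda>x. Re (G x * cnj (P x))) has_integral ?N) {a..b}"
    by (auto dest: has_integral_Re)
  have "0 \<le> integral {a..b} (\<lambda>x. (cmod (G x - P x))\<^sup>2)"
    by (intro integral_nonneg integrable_continuous_interval continuous_intros P assms) auto
  also have "(\<lambda>x. (cmod (G x - P x))\<^sup>2)
      = (\<lambda>x. (cmod (G x))\<^sup>2 - 2 * Re (G x * cnj (P x)) + (cmod (P x))\<^sup>2)"
    by (simp only: cmod_power2) (simp add: power2_eq_square algebra_simps)
  also have "integral {a..b} \<dots> = integral {a..b} (\<lambda>x. (cmod (G x))\<^sup>2) - 2 * ?N
      + integral {a..b} (\<lambda>x. (cmod (P x))\<^sup>2)"
    by (intro integral_unique has_integral_add has_integral_diff has_integral_mult_right cross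
        integrable_integral integrable_continuous_interval continuous_intros P assms)
  finally show ?thesis using part by (simp add: c_def)
qed

lemma arc_coeff_ell2:
  assumes "b \<le> a + 1" "continuous_on {a..b} G"
  shows "arc_coeff a b G \<in> ell2"
    "(ell2_norm (arc_coeff a b G))\<^sup>2 \<le> integral {a..b} (\<lambda>x. (cmod (G x))\<^sup>2)"
  using ell2I_bounded[OF Bessel_arc[OF assms]] by auto

section \<open>The Laplacian and band-limited sequences\<close>

lemma continuous_on_phi: "continuous_on S phi"
  unfolding phi_def by (intro continuous_intros)

lemma laplacian_arc_coeff:
  assumes "continuous_on {a..b} G"
  shows "laplacian (arc_coeff a b G) = arc_coeff a b (\<lambda>x. complex_of_real (phi x) * G x)"
proof
  fix n
  have "((\<lambda>x. (1 / 2) * (2 * (G x * unit_char (- (of_int n * x)))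
        - G x * unit_char (- (of_int (n + 1) * x)) - G x * unit_char (- (of_int (n - 1) * x))))
      has_integral laplacian (arc_coeff a b G) n) {a..b}"
    unfolding laplacian_def
    by (intro has_integral_mult_right has_integral_diff arc_coeff_has_integral assms)
  moreover have "(1 / 2) * (2 * (G x * unit_char (- (of_int n * x)))
        - G x * unit_char (- (of_int (n + 1) * x)) - G x * unit_char (- (of_int (n - 1) * x)))
      = complex_of_real (phi x) * G x * unit_char (- (of_int n * x))" for x
  proof -
    have "unit_char (- (of_int (n + 1) * x)) = unit_char (- (of_int n * x)) * unit_char (- x)"
      "unit_char (- (of_int (n - 1) * x)) = unit_char (- (of_int n * x)) * unit_char x"
      by (simp_all add: algebra_simps flip: unit_char_add)
    moreover have "unit_char (- x) = 2 - 2 * complex_of_real (phi x) - unit_char x"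
      by (simp add: unit_char_def phi_def complex_eq_iff)
    ultimately show ?thesis by (simp only:) (simp add: field_simps)
  qed
  ultimately show "laplacian (arc_coeff a b G) n = arc_coeff a b (\<lambda>x. complex_of_real (phi x) * G x) n"
    by (simp add: arc_coeff_def integral_unique)
qed

lemma laplacian_ell2: "f \<in> ell2 \<Longrightarrow> laplacian f \<in> ell2"
  using ell2_shift[of f 1] ell2_shift[of f "-1"] unfolding laplacian_def
  by (intro ell2_scale ell2_diff) auto

lemma ell2_inner_shift:
  "ell2_inner (\<lambda>n. f (n + k)) g = ell2_inner f (\<lambda>n. g (n - k))"
proof -
  have "bij_betw (\<lambda>n. n + k) UNIV (UNIV :: int set)"
    by (rule bij_betw_byWitness[where f' = "\<lambda>n. n - k"]) auto
  from infsum_reindex_bij_betw[OF this, of "\<lambda>n. f n * cnj (g (n - k))"]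
  show ?thesis by (simp add: ell2_inner_def)
qed

lemma laplacian_self_adjoint:
  assumes "f \<in> ell2" "g \<in> ell2"
  shows "ell2_inner (laplacian f) g = ell2_inner f (laplacian g)"
proof -
  have sh: "(\<lambda>n. h (n + 1)) \<in> ell2" "(\<lambda>n. h (n - 1)) \<in> ell2" if "h \<in> ell2" for h
    using ell2_shift[OF that, of 1] ell2_shift[OF that, of "-1"] by simp_all
  have "ell2_inner (laplacian f) g
      = (1 / 2) * (2 * ell2_inner f g - ell2_inner (\<lambda>n. f (n + 1)) g - ell2_inner (\<lambda>n. f (n - 1)) g)"
    unfolding laplacian_def using assms sh[OF assms(1)]
    by (simp only: ell2_inner_scale_left ell2_inner_diff_left ell2_diff ell2_scale)
  also have "\<dots> = (1 / 2) * (2 * ell2_inner f g - ell2_inner f (\<lambda>n. g (n + 1)) - ell2_inner f (\<lambda>n. g (n - 1)))"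
    using ell2_inner_shift[of f 1 g] ell2_inner_shift[of f "-1" g] by simp
  also have "\<dots> = ell2_inner f (laplacian g)"
    unfolding laplacian_def using assms sh[OF assms(2)]
    by (simp only: ell2_inner_scale_right ell2_inner_diff_right ell2_diff ell2_scale) simp
  finally show ?thesis .
qed

text \<open>Fourier coefficients over an arc off the band are orthogonal to \<open>GPW\<close>: they lie in the range of
  every power of \<open>S = laplacian - r\<close>, with preimages under \<open>S ^ k\<close> of norm \<open>o (1 / r ^ k)\<close>, while
  \<open>S ^ k\<close> multiplies the norm of \<open>f\<close> by at most \<open>r ^ k\<close>. Equality \<open>phi = 2 r\<close> is admitted at the endpoints,
  where the two rates agree, since the arcs used for sampling touch the band.\<close>

lemma GPW_orthogonal_arc_coeff:
  assumes f: "f \<in> GPW (2 * r)" and r: "r > 0" and ab: "b \<le> a + 1"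
    and ge: "\<And>x. x \<in> {a..b} \<Longrightarrow> phi x \<ge> 2 * r"
    and gt: "\<And>x. x \<in> {a<..<b} \<Longrightarrow> phi x > 2 * r"
    and G: "continuous_on {a..b} G"
  shows "ell2_inner f (arc_coeff a b G) = 0"
proof -
  obtain E where fl: "f \<in> ell2" and E: "is_spectral_measure laplacian E" "E {0..2 * r} f = f"
    using f unfolding GPW_def spectral_subspace_def by blast
  have lin: "laplacian (\<lambda>n. c * u n + d * v n) = (\<lambda>n. c * laplacian u n + d * laplacian v n)" for u v c d
    by (simp add: laplacian_def fun_eq_iff field_simps)
  interpret ell2_spectral E laplacian
    by unfold_locales (use E(1) in \<open>simp_all add: is_spectral_measure_def laplacian_ell2 lin\<close>)
  define S where "S = (\<lambda>u n. laplacian u n - complex_of_real r * u n)"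
  \<comment> \<open>\<open>g k\<close> is a preimage of \<open>arc_coeff a b G\<close> under \<open>S ^^ k\<close>.\<close>
  define H where "H = (\<lambda>k x. G x / complex_of_real (phi x - r) ^ k)"
  define g where "g = (\<lambda>k. arc_coeff a b (H k))"
  have ne: "complex_of_real (phi x - r) \<noteq> 0" if "x \<in> {a..b}" for x
    using ge[OF that] r by (simp flip: of_real_diff)
  have H: "continuous_on {a..b} (H k)" for k
    unfolding H_def by (intro continuous_intros G continuous_on_phi) (use ne in auto)
  have g: "g k \<in> ell2" "(ell2_norm (g k))\<^sup>2 \<le> integral {a..b} (\<lambda>x. (cmod (H k x))\<^sup>2)" for k
    unfolding g_def by (rule arc_coeff_ell2[OF ab H])+
  have Sg: "S (g (Suc k)) = g k" for k
  proof
    fix n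
    have "((\<lambda>x. (complex_of_real (phi x) * H (Suc k) x) * unit_char (- (of_int n * x))
        - complex_of_real r * (H (Suc k) x * unit_char (- (of_int n * x)))) has_integral
        S (g (Suc k)) n) {a..b}"
      unfolding S_def g_def laplacian_arc_coeff[OF H]
      by (intro has_integral_diff has_integral_mult_right arc_coeff_has_integral H
          continuous_intros continuous_on_phi)
    moreover have "(complex_of_real (phi x) * H (Suc k) x) * unit_char (- (of_int n * x))
        - complex_of_real r * (H (Suc k) x * unit_char (- (of_int n * x)))
        = H k x * unit_char (- (of_int n * x))" if "x \<in> {a..b}" for x
      using ne[OF that] by (simp add: H_def divide_simps) (simp add: algebra_simps)
    ultimately have "((\<lambda>x. H k x * unit_char (- (of_int n * x))) has_integral S (g (Suc k)) n) {a..b}"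
      by (rule has_integral_eq[rotated])
    then show "S (g (Suc k)) n = g k n"
      by (simp add: g_def arc_coeff_def integral_unique)
  qed
  have Sl: "S u \<in> ell2" if "u \<in> ell2" for u
    unfolding S_def using that by (intro ell2_diff ell2_scale laplacian_ell2)
  have Ssa: "ell2_inner (S u) v = ell2_inner u (S v)" if "u \<in> ell2" "v \<in> ell2" for u v
    using that unfolding S_def
    by (simp add: ell2_inner_diff_left ell2_inner_diff_right ell2_scale laplacian_ell2
        ell2_inner_scale_left ell2_inner_scale_right laplacian_self_adjoint)
  have iter: "(S ^^ k) f \<in> ell2 \<and> E {0..2 * r} ((S ^^ k) f) = (S ^^ k) f
      \<and> ell2_norm ((S ^^ k) f) \<le> r ^ k * ell2_norm f
      \<and> ell2_inner f (g 0) = ell2_inner ((S ^^ k) f) (g k)" for k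
  proof (induction k)
    case 0
    then show ?case using fl E by simp
  next
    case (Suc k)
    define u where "u = (S ^^ k) f"
    have u: "u \<in> ell2" "E {0..2 * r} u = u" using Suc by (auto simp: u_def)
    have "E {0..2 * r} (S u) = S u"
      using E_linear[OF _ laplacian_ell2[OF u(1)] u(1), of "{0..2 * r}" 1 "- complex_of_real r"]
        T_invariant[OF _ u] u by (simp add: S_def)
    moreover have "ell2_norm (S u) \<le> r * ell2_norm u"
      unfolding S_def by (rule centred_contraction[OF u r laplacian_self_adjoint])
    then have "ell2_norm (S u) \<le> r * (r ^ k * ell2_norm f)"
      using Suc r by (auto simp: u_def intro: order_trans mult_left_mono)
    moreover have "ell2_inner (S u) (g (Suc k)) = ell2_inner u (g k)"
      using u g(1) by (simp add: Ssa Sg)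
    ultimately show ?case using Suc Sl[OF u(1)] by (simp add: u_def mult.assoc)
  qed
  let ?q = "\<lambda>k x. (cmod (G x))\<^sup>2 * ((r / (phi x - r))\<^sup>2) ^ k"
  have q_cont: "continuous_on {a..b} (?q k)" for k
    by (intro continuous_intros G continuous_on_phi) (use ge r in force)
  have bound: "(cmod (ell2_inner f (g 0)))\<^sup>2 \<le> (ell2_norm f)\<^sup>2 * integral {a<..<b} (?q k)" for k
  proof -
    have "cmod (ell2_inner f (g 0)) \<le> ell2_norm ((S ^^ k) f) * ell2_norm (g k)"
      using iter[of k] g(1)[of k] ell2_Cauchy_Schwarz[of "(S ^^ k) f" "g k"] by simp
    also have "\<dots> \<le> (r ^ k * ell2_norm f) * ell2_norm (g k)"
      using iter[of k] by (intro mult_right_mono ell2_norm_nonneg) auto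
    finally have "(cmod (ell2_inner f (g 0)))\<^sup>2 \<le> ((r ^ k * ell2_norm f) * ell2_norm (g k))\<^sup>2"
      by (intro power_mono) auto
    also have "\<dots> = (ell2_norm f)\<^sup>2 * ((r\<^sup>2) ^ k * (ell2_norm (g k))\<^sup>2)"
      by (simp add: power_mult_distrib power_mult[symmetric] mult_ac)
    also have "\<dots> \<le> (ell2_norm f)\<^sup>2 * ((r\<^sup>2) ^ k * integral {a..b} (\<lambda>x. (cmod (H k x))\<^sup>2))"
      by (intro mult_left_mono g(2)) auto
    also have "(r\<^sup>2) ^ k * integral {a..b} (\<lambda>x. (cmod (H k x))\<^sup>2) = integral {a..b} (?q k)"
    proof -
      have "(r\<^sup>2) ^ k * (cmod (H k x))\<^sup>2 = ?q k x" for x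
        by (simp add: H_def norm_divide norm_power power_divide flip: of_real_diff power_mult)
           (simp add: power_even_abs mult_ac)
      then show ?thesis by (simp flip: integral_mult_right)
    qed
    finally show ?thesis by (simp add: integral_open_interval_real)
  qed
  \<comment> \<open>The ratio \<open>r / (phi x - r)\<close> reaches \<open>1\<close> at most at the endpoints, so the passage to the limit
    takes place on the open interval.\<close>
  have "(\<lambda>k. integral {a<..<b} (?q k)) \<longlonglongrightarrow> integral {a<..<b} (\<lambda>x. 0 :: real)"
  proof (rule dominated_convergence(2)[where h = "\<lambda>x. (cmod (G x))\<^sup>2"])
    show "?q k integrable_on {a<..<b}" for k
      unfolding integrable_on_open_interval_real by (intro integrable_continuous_interval q_cont)
    show "(\<lambda>x. (cmod (G x))\<^sup>2) integrable_on {a<..<b}"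
      unfolding integrable_on_open_interval_real
      by (intro integrable_continuous_interval continuous_intros G)
    fix x assume x: "x \<in> {a<..<b}"
    have lt: "0 \<le> (r / (phi x - r))\<^sup>2" "(r / (phi x - r))\<^sup>2 < 1"
      using gt[OF x] r by (simp_all add: abs_square_less_1)
    show "norm (?q k x) \<le> (cmod (G x))\<^sup>2" for k
      using lt by (simp add: abs_mult mult_left_le power_le_one)
    show "(\<lambda>k. ?q k x) \<longlonglongrightarrow> 0"
      using tendsto_mult_right_zero[OF LIMSEQ_realpow_zero[OF lt]] by simp
  qed
  then have "(\<lambda>k. (ell2_norm f)\<^sup>2 * integral {a<..<b} (?q k)) \<longlonglongrightarrow> 0"
    by (intro tendsto_mult_right_zero) simp
  then have "(cmod (ell2_inner f (g 0)))\<^sup>2 \<le> 0"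
    by (rule LIMSEQ_le_const) (use bound in blast)
  moreover have "g 0 = arc_coeff a b G" by (simp add: g_def H_def)
  ultimately show ?thesis by simp
qed

section \<open>Cardinal sine series\<close>

lemma nsinc_minus: "nsinc (- x) = nsinc x"
  by (simp add: nsinc_def)

lemma nsinc_int: "nsinc (of_int k) = (if k = 0 then 1 else 0)"
  using sin_npi_int[of k] by (simp add: nsinc_def)

text \<open>The coefficients over the arc of length \<open>1 / N\<close> around \<open>q / N\<close> are the modulated cardinal
  sine: moving the centre from \<open>0\<close> to \<open>q / N\<close> multiplies them by a character.\<close>

lemma arc_coeff_char:
  assumes "N > (0::nat)"
  shows "arc_coeff ((q - 1/2) / N) ((q + 1/2) / N) (\<lambda>x. unit_char (of_int m * x)) n
    = unit_char (q * of_int (m - n) / N) * complex_of_real (nsinc (of_int (m - n) / N)) / N"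
proof -
  define k where "k = real_of_int (m - n)"
  let ?a = "(q - 1/2) / N" and ?b = "(q + 1/2) / N"
  have "unit_char (of_int m * x) * unit_char (- (of_int n * x)) = unit_char (k * x)" for x
    unfolding unit_char_add[symmetric] by (simp add: k_def algebra_simps)
  then have *: "arc_coeff ?a ?b (\<lambda>x. unit_char (of_int m * x)) n
      = integral {?a..?b} (\<lambda>x. unit_char (k * x))"
    by (simp add: arc_coeff_def)
  have le: "?a \<le> ?b" using assms by (simp add: divide_right_mono)
  have "integral {?a..?b} (\<lambda>x. unit_char (k * x))
      = unit_char (q * k / N) * complex_of_real (nsinc (k / N)) / N"
  proof (cases "k = 0")
    case True
    have "?b - ?a = 1 / N" by (simp flip: diff_divide_distrib)
    then show ?thesis using True le by (simp add: nsinc_def scaleR_conv_of_real)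
  next
    case False
    have "unit_char (k * ?b) = unit_char (q * k / N) * unit_char (k / (2 * N))"
      "unit_char (k * ?a) = unit_char (q * k / N) * unit_char (- (k / (2 * N)))"
      using assms by (simp_all add: field_simps flip: unit_char_add)
    moreover have "unit_char (k / (2 * N)) - unit_char (- (k / (2 * N)))
        = 2 * \<i> * complex_of_real (sin (pi * (k / N)))"
      using assms by (simp add: unit_char_def complex_eq_iff)
    ultimately have "unit_char (k * ?b) - unit_char (k * ?a)
        = unit_char (q * k / N) * (2 * \<i> * complex_of_real (sin (pi * (k / N))))"
      by (simp flip: right_diff_distrib)
    then show ?thesis
      using unit_char_has_integral[OF le False] False assms
      by (simp add: integral_unique nsinc_def field_simps)
  qed
  with * show ?thesis by (simp add: k_def)
qed

lemma sum_roots_of_unity: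
  assumes "N > (0::nat)"
  shows "(\<Sum>q<N. unit_char (real q * of_int k / N)) = (if int N dvd k then of_nat N else 0)"
proof -
  define z where "z = unit_char (of_int k / N)"
  have pow: "z ^ q = unit_char (real q * of_int k / N)" for q
    by (simp add: z_def unit_char_power)
  have zN: "z ^ N = 1" unfolding pow using assms by simp
  show ?thesis
  proof (cases "int N dvd k")
    case True
    then obtain j where "k = int N * j" by blast
    then have "z = 1" using assms by (simp add: z_def)
    then show ?thesis using True by (simp flip: pow)
  next
    case False
    have "z \<noteq> 1"
    proof
      assume "z = 1"
      then have "of_int k / real N \<in> \<int>" unfolding z_def by (rule unit_char_eq_1D)
      then obtain j :: int where "of_int k / real N = of_int j" by (auto elim: Ints_cases)
      then have "real_of_int k = of_int (int N * j)" using assms by (simp add: field_simps)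
      then have "k = int N * j" by (simp only: of_int_eq_iff)
      with False show False by simp
    qed
    then show ?thesis using False geometric_sum[of z N] zN by (simp add: pow)
  qed
qed

lemma phi_gt_off_band:
  assumes "N > (0::nat)" "x \<in> {1 / (2 * real N)<..<1 - 1 / (2 * real N)}"
  shows "phi x > phi (1 / (2 * real N))"
proof -
  define t where "t = 1 / (2 * real N)"
  have t: "0 < t" "t \<le> 1 / 2" using assms(1) by (simp_all add: t_def field_simps)
  have strict: "phi t < phi y" if "t < y" "y \<le> 1 / 2" for y
    unfolding phi_def using that t by (auto intro!: cos_monotone_0_pi)
  have "phi (1 - x) = phi x" by (simp add: phi_eq_sin right_diff_distrib sin_diff)
  then show ?thesis
    using strict[of x] strict[of "1 - x"] assms(2) by (cases "x \<le> 1 / 2") (auto simp: t_def)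
qed

lemma phi_ge_off_band:
  assumes "N > (0::nat)" "x \<in> {1 / (2 * real N)..1 - 1 / (2 * real N)}"
  shows "phi x \<ge> phi (1 / (2 * real N))"
proof (cases "x = 1 / (2 * real N) \<or> x = 1 - 1 / (2 * real N)")
  case True
  moreover have "phi (1 - y) = phi y" for y by (simp add: phi_eq_sin right_diff_distrib sin_diff)
  ultimately show ?thesis by auto
next
  case False
  with assms show ?thesis by (intro less_imp_le phi_gt_off_band) auto
qed

text \<open>A cardinal sine series consists of the Fourier coefficients over the band of the trigonometric
  polynomial with frequencies in \<open>N \<int>\<close>, whose norm over the band, an interval of length
  \<open>1 / N\<close>, is explicit.\<close>

lemma synthesis_bound:
  fixes c :: "int \<Rightarrow> complex"
  assumes N: "N > (0::nat)" and F: "finite F"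
  shows "(\<lambda>m. \<Sum>j\<in>F. c j * complex_of_real (nsinc (of_int m / N - of_int j))) \<in> ell2"
    "(ell2_norm (\<lambda>m. \<Sum>j\<in>F. c j * complex_of_real (nsinc (of_int m / N - of_int j))))\<^sup>2
      \<le> N * (\<Sum>j\<in>F. (cmod (c j))\<^sup>2)"
proof -
  let ?a = "- 1 / (2 * real N)" and ?b = "1 / (2 * real N)"
  define P where "P = (\<lambda>x::real. \<Sum>j\<in>F. c j * unit_char (real N * of_int j * x))"
  define G where "G = (\<lambda>x::real. of_nat N * P x)"
  have G: "continuous_on S G" for S unfolding G_def P_def by (intro continuous_intros)
  have ab: "?b = ?a + 1 / N" "?b \<le> ?a + 1" using N by (simp_all add: field_simps)
  have "arc_coeff ?a ?b G m = (\<Sum>j\<in>F. c j * complex_of_real (nsinc (of_int m / N - of_int j)))" for m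
  proof -
    have hi: "((\<lambda>x. unit_char (of_int (int N * j) * x) * unit_char (- (of_int m * x))) has_integral
        complex_of_real (nsinc (of_int m / N - of_int j)) / N) {?a..?b}" for j
    proof -
      have "continuous_on {?a..?b} (\<lambda>x. unit_char (of_int (int N * j) * x))"
        by (intro continuous_intros)
      note arc_coeff_has_integral[OF this, of m]
      also have "arc_coeff ?a ?b (\<lambda>x. unit_char (of_int (int N * j) * x)) m
          = complex_of_real (nsinc (of_int (int N * j - m) / N)) / N"
        using arc_coeff_char[OF N, of 0 "int N * j" m] by simp
      also have "nsinc (of_int (int N * j - m) / N) = nsinc (of_int m / N - of_int j)"
        using N nsinc_minus[of "of_int m / N - of_int j"] by (simp add: diff_divide_distrib)
      finally show ?thesis .
    qed
    have "((\<lambda>x. of_nat N * (\<Sum>j\<in>F. c j * (unit_char (of_int (int N * j) * x) * unit_char (- (of_int m * x)))))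
       has_integral of_nat N * (\<Sum>j\<in>F. c j * (complex_of_real (nsinc (of_int m / N - of_int j)) / N)))
       {?a..?b}"
      by (intro has_integral_mult_right has_integral_sum hi F)
    moreover have "(\<lambda>x. of_nat N * (\<Sum>j\<in>F. c j * (unit_char (of_int (int N * j) * x) * unit_char (- (of_int m * x)))))
      = (\<lambda>x. G x * unit_char (- (of_int m * x)))"
      by (simp add: G_def P_def sum_distrib_left sum_distrib_right mult_ac)
    moreover have "of_nat N * (\<Sum>j\<in>F. c j * (complex_of_real (nsinc (of_int m / N - of_int j)) / N))
      = (\<Sum>j\<in>F. c j * complex_of_real (nsinc (of_int m / N - of_int j)))"
      using N by (simp add: sum_distrib_left)
    ultimately show ?thesis by (simp add: arc_coeff_def integral_unique)
  qed
  then have eq: "(\<lambda>m. \<Sum>j\<in>F. c j * complex_of_real (nsinc (of_int m / N - of_int j))) = arc_coeff ?a ?b G"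
    by auto
  have "((\<lambda>x. (real N)\<^sup>2 * (cmod (P x))\<^sup>2) has_integral (real N)\<^sup>2 * ((\<Sum>j\<in>F. (cmod (c j))\<^sup>2) / N)) {?a..?b}"
    unfolding P_def ab(1) using N
    by (intro has_integral_mult_right trig_poly_norm_has_integral F) auto
  moreover have "(real N)\<^sup>2 * (cmod (P x))\<^sup>2 = (cmod (G x))\<^sup>2" for x
    by (simp add: G_def norm_mult power_mult_distrib)
  moreover have "(real N)\<^sup>2 * ((\<Sum>j\<in>F. (cmod (c j))\<^sup>2) / N) = N * (\<Sum>j\<in>F. (cmod (c j))\<^sup>2)"
    using N by (simp add: power2_eq_square)
  ultimately have "integral {?a..?b} (\<lambda>x. (cmod (G x))\<^sup>2) = N * (\<Sum>j\<in>F. (cmod (c j))\<^sup>2)"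
    by (simp only: integral_unique)
  then show "(\<lambda>m. \<Sum>j\<in>F. c j * complex_of_real (nsinc (of_int m / N - of_int j))) \<in> ell2"
    "(ell2_norm (\<lambda>m. \<Sum>j\<in>F. c j * complex_of_real (nsinc (of_int m / N - of_int j))))\<^sup>2
      \<le> N * (\<Sum>j\<in>F. (cmod (c j))\<^sup>2)"
    unfolding eq using arc_coeff_ell2[OF ab(2) G] by auto
qed

text \<open>The remainder after a finite set \<open>F\<close> of terms is estimated on finitely many indices \<open>m\<close> at a time:
  there it is the pointwise limit of finite sums over sets disjoint from \<open>F\<close>, which
  \<open>synthesis_bound\<close> controls by the tail of \<open>\<Sum> \<bar>c j\<bar>\<^sup>2\<close>.\<close>

lemma synthesis_ell2_has_sum:
  fixes c f :: "int \<Rightarrow> complex"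
  assumes N: "N > (0::nat)" and c: "c \<in> ell2"
    and pw: "\<And>m. ((\<lambda>j. c j * complex_of_real (nsinc (of_int m / N - of_int j))) has_sum f m) UNIV"
  shows "ell2_has_sum (\<lambda>j m. c j * complex_of_real (nsinc (of_int m / N - of_int j))) UNIV f"
proof -
  let ?g = "\<lambda>j m. c j * complex_of_real (nsinc (of_int m / N - of_int j))"
  let ?C = "(ell2_norm c)\<^sup>2" and ?s = "\<lambda>F. \<Sum>j\<in>F. (cmod (c j))\<^sup>2"
  have rem: "(\<lambda>m. f m - (\<Sum>j\<in>F. ?g j m)) \<in> ell2 \<and>
      (ell2_norm (\<lambda>m. f m - (\<Sum>j\<in>F. ?g j m)))\<^sup>2 \<le> N * (?C - ?s F)" if F: "finite F" for F
  proof -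
    have "(\<Sum>m\<in>M. (cmod (f m - (\<Sum>j\<in>F. ?g j m)))\<^sup>2) \<le> N * (?C - ?s F)" if M: "finite M" for M
    proof (rule tendsto_upperbound)
      show "((\<lambda>F'. \<Sum>m\<in>M. (cmod ((\<Sum>j\<in>F'. ?g j m) - (\<Sum>j\<in>F. ?g j m)))\<^sup>2)
          \<longlongrightarrow> (\<Sum>m\<in>M. (cmod (f m - (\<Sum>j\<in>F. ?g j m)))\<^sup>2)) (finite_subsets_at_top UNIV)"
        by (intro tendsto_intros pw[unfolded has_sum_def])
      show "\<forall>\<^sub>F F' in finite_subsets_at_top UNIV.
          (\<Sum>m\<in>M. (cmod ((\<Sum>j\<in>F'. ?g j m) - (\<Sum>j\<in>F. ?g j m)))\<^sup>2) \<le> N * (?C - ?s F)"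
        unfolding eventually_finite_subsets_at_top
      proof (intro exI[of _ F] conjI allI impI F subset_UNIV)
        fix F' :: "int set" assume "finite F' \<and> F \<subseteq> F' \<and> F' \<subseteq> UNIV"
        then have F': "finite F'" "F \<subseteq> F'" "finite (F' - F)" by auto
        have "(\<Sum>m\<in>M. (cmod ((\<Sum>j\<in>F'. ?g j m) - (\<Sum>j\<in>F. ?g j m)))\<^sup>2)
            = (\<Sum>m\<in>M. (cmod (\<Sum>j\<in>F' - F. ?g j m))\<^sup>2)"
          using F' by (simp add: sum_diff)
        also have "\<dots> \<le> (ell2_norm (\<lambda>m. \<Sum>j\<in>F' - F. ?g j m))\<^sup>2"
          by (intro finite_sum_le_ell2_norm synthesis_bound N F' M)
        also have "\<dots> \<le> N * ?s (F' - F)"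
          by (intro synthesis_bound N F')
        also have "?s (F' - F) = ?s F' - ?s F" using F' by (simp add: sum_diff)
        also have "N * \<dots> \<le> N * (?C - ?s F)"
          using finite_sum_le_ell2_norm[OF c F'(1)] by (intro mult_left_mono) auto
        finally show "(\<Sum>m\<in>M. (cmod ((\<Sum>j\<in>F'. ?g j m) - (\<Sum>j\<in>F. ?g j m)))\<^sup>2) \<le> N * (?C - ?s F)" .
      qed
    qed simp
    from ell2I_bounded[OF this] show ?thesis by simp
  qed
  have g: "?g j \<in> ell2" for j using synthesis_bound(1)[OF N, of "{j}" c] by simp
  have "(?s \<longlongrightarrow> ?C) (finite_subsets_at_top UNIV)"
    using has_sum_infsum[of "\<lambda>n. (cmod (c n))\<^sup>2" UNIV] c
    by (simp add: ell2_def ell2_norm_sq has_sum_def)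
  then have "((\<lambda>F. sqrt (N * (?C - ?s F))) \<longlongrightarrow> sqrt (N * (?C - ?C))) (finite_subsets_at_top UNIV)"
    by (intro tendsto_intros)
  then have lim: "((\<lambda>F. sqrt (N * (?C - ?s F))) \<longlongrightarrow> 0) (finite_subsets_at_top UNIV)" by simp
  have "((\<lambda>F. ell2_norm (\<lambda>m. f m - (\<Sum>j\<in>F. ?g j m))) \<longlongrightarrow> 0) (finite_subsets_at_top UNIV)"
  proof (rule Lim_null_comparison[OF _ lim], rule eventually_finite_subsets_at_top_weakI)
    fix F :: "int set" assume "finite F"
    then show "norm (ell2_norm (\<lambda>m. f m - (\<Sum>j\<in>F. ?g j m))) \<le> sqrt (N * (?C - ?s F))"
      using rem[of F] by (simp add: ell2_norm_nonneg real_le_rsqrt)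
  qed
  moreover have "f \<in> ell2" using rem[of "{}"] by simp
  ultimately show ?thesis using g by (simp add: ell2_has_sum_def)
qed

section \<open>The sampling theorem\<close>

text \<open>The function \<open>h q\<close> belongs to the arc around \<open>q / N\<close>. Since \<open>f\<close> is orthogonal to \<open>h q\<close> for
  \<open>0 < q < N\<close>, a weighted sum of the inner products \<open>\<langle>f, h q\<rangle>\<close> over all \<open>q\<close> only sees \<open>q = 0\<close>.
  Constant weights sum the conjugates of the \<open>h q\<close> to a point mass at \<open>m\<close>, whereas weights \<open>unit_char (q * m / N)\<close> sum
  them to the cardinal sine restricted to the multiples of \<open>N\<close>; summing \<open>f\<close> against
  either one therefore gives \<open>\<langle>f, h 0\<rangle>\<close>.\<close>

lemma GPW_sampling_pointwise:
  fixes f :: "int \<Rightarrow> complex"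
  assumes N: "N > (0::nat)" and f: "f \<in> GPW (phi (1 / (2 * real N)))"
  shows "((\<lambda>j. f (int N * j) * complex_of_real (nsinc (of_int m / real N - of_int j))) has_sum f m) UNIV"
proof -
  define r where "r = phi (1 / (2 * real N)) / 2"
  have fl: "f \<in> ell2" using f by (simp add: GPW_def spectral_subspace_def)
  have r: "r > 0" "f \<in> GPW (2 * r)"
  proof -
    have "pi * (1 / (2 * real N)) < pi * 1" using N by (intro mult_strict_left_mono) (auto simp: field_simps)
    moreover have "0 < pi * (1 / (2 * real N))" using N by simp
    ultimately have "0 < sin (pi * (1 / (2 * real N)))" by (intro sin_gt_zero) simp_all
    then show "r > 0" by (simp add: r_def phi_eq_sin)
    show "f \<in> GPW (2 * r)" using f by (simp add: r_def)
  qed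
  define s where "s = (\<lambda>n. complex_of_real (nsinc (of_int (m - n) / real N)))"
  define h where "h = (\<lambda>q::nat. arc_coeff ((real q - 1/2) / real N) ((real q + 1/2) / real N)
      (\<lambda>x. unit_char (of_int m * x)))"
  have len: "(real q + 1/2) / real N \<le> (real q - 1/2) / real N + 1" for q :: nat
    using N by (simp add: field_simps)
  have chm: "continuous_on A (\<lambda>x. unit_char (of_int m * x))" for A by (intro continuous_intros)
  have hl: "h q \<in> ell2" for q unfolding h_def by (rule arc_coeff_ell2[OF len chm])
  have h: "cnj (h q n) = unit_char (real q * of_int (n - m) / N) * s n / N" for q n
    unfolding h_def arc_coeff_char[OF N] by (simp add: cnj_unit_char s_def algebra_simps minus_divide_left)
  have orth: "ell2_inner f (h q) = 0" if q: "q \<in> {1..<N}" for q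
  proof -
    have q': "1 \<le> real q" "real q + 1 \<le> real N" using q by auto
    have half: "1 / (2 * real N) = (1/2) / real N" and co: "1 - (1/2) / real N = (real N - 1/2) / real N"
      using N by (simp_all add: field_simps)
    have ends: "1 / (2 * real N) \<le> (real q - 1/2) / real N"
      "(real q + 1/2) / real N \<le> 1 - 1 / (2 * real N)"
      unfolding half co by (rule divide_right_mono; use q' in simp)+
    show ?thesis
      unfolding h_def
    proof (rule GPW_orthogonal_arc_coeff[OF r(2,1) len])
      show "2 * r \<le> phi x" if "x \<in> {(real q - 1/2) / real N..(real q + 1/2) / real N}" for x
        using phi_ge_off_band[OF N, of x] that ends by (simp add: r_def)
      show "2 * r < phi x" if "x \<in> {(real q - 1/2) / real N<..<(real q + 1/2) / real N}" for x
        using phi_gt_off_band[OF N, of x] that ends by (simp add: r_def)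
    qed (rule chm)
  qed
  define X where "X = ell2_inner f (h 0)"
  have hs: "((\<lambda>n. \<Sum>q<N. w q * (f n * cnj (h q n))) has_sum w 0 * X) UNIV" for w :: "nat \<Rightarrow> complex"
  proof -
    have "((\<lambda>n. \<Sum>q\<in>Q. w q * (f n * cnj (h q n))) has_sum (\<Sum>q\<in>Q. w q * ell2_inner f (h q))) UNIV"
      if "finite Q" for Q
      using that
      by (induction Q) (simp_all add: has_sum_add has_sum_cmult_right ell2_inner_has_sum fl hl)
    from this[OF finite_lessThan]
    have "((\<lambda>n. \<Sum>q<N. w q * (f n * cnj (h q n))) has_sum (\<Sum>q<N. w q * ell2_inner f (h q))) UNIV" .
    also have "(\<Sum>q<N. w q * ell2_inner f (h q)) = (\<Sum>q\<in>{0}. w q * ell2_inner f (h q))"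
      using N orth by (intro sum.mono_neutral_right) auto
    finally show ?thesis by (simp add: X_def)
  qed
  \<comment> \<open>Constant weights: \<open>\<langle>f, h 0\<rangle> = f m\<close>.\<close>
  have "(\<Sum>q<N. 1 * (f n * cnj (h q n))) = (if n = m then f m else 0)" for n
  proof -
    have "(\<Sum>q<N. 1 * (f n * cnj (h q n)))
        = f n * s n / N * (\<Sum>q<N. unit_char (real q * of_int (n - m) / N))"
      by (simp add: h sum_distrib_left mult_ac)
    also have "\<dots> = (if n = m then f m else 0)"
    proof (cases "int N dvd n - m")
      case True
      then obtain j where j: "n - m = int N * j" by blast
      then have "m - n = int N * (- j)" by simp
      then have "of_int (m - n) / real N = of_int (- j)" using N by (simp only: of_int_mult) simp
      then have "s n = (if j = 0 then 1 else 0)" unfolding s_def by (simp only: nsinc_int) simp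
      moreover have "n = m \<longleftrightarrow> j = 0" using N j by auto
      ultimately show ?thesis
        unfolding sum_roots_of_unity[OF N] using N True by auto
    next
      case False
      then show ?thesis unfolding sum_roots_of_unity[OF N] by auto
    qed
    finally show ?thesis .
  qed
  then have "((\<lambda>n. if n = m then f m else 0) has_sum X) UNIV" using hs[of "\<lambda>_. 1"] by simp
  moreover have "((\<lambda>n. if n = m then f m else 0) has_sum f m) UNIV"
    by (rule has_sum_finite_neutralI[of "{m}"]) auto
  ultimately have X: "X = f m" by (rule has_sum_unique)
  \<comment> \<open>Weights that shift the phase by \<open>m\<close>: the sum over \<open>q\<close> selects the multiples of \<open>N\<close>.\<close>
  have "(\<Sum>q<N. unit_char (real q * of_int m / N) * (f n * cnj (h q n)))
      = (if int N dvd n then f n * s n else 0)" for n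
  proof -
    have "unit_char (real q * of_int m / N) * unit_char (real q * of_int (n - m) / N)
        = unit_char (real q * of_int n / N)" for q
      unfolding unit_char_add[symmetric] by (simp add: add_divide_distrib[symmetric] algebra_simps)
    then have "unit_char (real q * of_int m / N) * (f n * cnj (h q n))
        = f n * s n / N * unit_char (real q * of_int n / N)" for q
      by (simp add: h mult_ac)
    then have "(\<Sum>q<N. unit_char (real q * of_int m / N) * (f n * cnj (h q n)))
        = f n * s n / N * (\<Sum>q<N. unit_char (real q * of_int n / N))"
      by (simp only: sum_distrib_left)
    then show ?thesis using N by (simp add: sum_roots_of_unity)
  qed
  then have "((\<lambda>n. if int N dvd n then f n * s n else 0) has_sum f m) UNIV"
    using hs[of "\<lambda>q. unit_char (real q * of_int m / N)"] X by simp
  also have "?this \<longleftrightarrow> ((\<lambda>n. f n * s n) has_sum f m) (range (\<lambda>j. int N * j))"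
    by (rule has_sum_cong_neutral) (auto simp: dvd_def)
  also have "\<dots> \<longleftrightarrow> (((\<lambda>n. f n * s n) \<circ> (\<lambda>j. int N * j)) has_sum f m) UNIV"
    using N by (intro has_sum_reindex) (auto simp: inj_on_def)
  also have "(\<lambda>n. f n * s n) \<circ> (\<lambda>j. int N * j)
      = (\<lambda>j. f (int N * j) * complex_of_real (nsinc (of_int m / real N - of_int j)))"
    using N by (simp add: fun_eq_iff s_def diff_divide_distrib)
  finally show ?thesis .
qed

theorem theorem3p7:
  fixes l :: int and \<omega> :: real and f :: "int \<Rightarrow> complex"
  assumes "l \<ge> 1"
    and "\<omega> = phi (1 / (2 * real_of_int l))"
    and "f \<in> GPW \<omega>"
  shows "(\<forall>m::int. ((\<lambda>j::int. f (l * j) *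
              complex_of_real (nsinc (real_of_int m / real_of_int l - real_of_int j)))
            has_sum f m) UNIV) \<and>
         ell2_has_sum (\<lambda>(j::int) (m::int). f (l * j) *
              complex_of_real (nsinc (real_of_int m / real_of_int l - real_of_int j)))
            UNIV f"
proof -
  define N where "N = nat l"
  have N: "N > 0" "l = int N" using assms(1) by (simp_all add: N_def)
  have f: "f \<in> GPW (phi (1 / (2 * real N)))" using assms(2,3) N by simp
  note pw = GPW_sampling_pointwise[OF N(1) f]
  have "f \<in> ell2" using f by (simp add: GPW_def spectral_subspace_def)
  then have "(\<lambda>n. (cmod (f n))\<^sup>2) summable_on range (\<lambda>j. int N * j)"
    unfolding ell2_def by (auto intro: summable_on_subset_banach)
  moreover have "inj (\<lambda>j. int N * j)" using N by (auto simp: inj_on_def)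
  ultimately have "(\<lambda>j. f (int N * j)) \<in> ell2"
    by (simp add: ell2_def summable_on_reindex comp_def)
  from synthesis_ell2_has_sum[OF N(1) this pw] pw show ?thesis
    by (simp add: N(2))
qed

end
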